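(* Let $V$ be a digraph on $\mathcal N=\{1,\dots,N\}$ without loops whose weights are potential: there are real numbers $p_{ii}$ ($i\in\mathcal N$) and a non-directed graph $P$ on $\mathcal N$ with real edge weights $p_{ij}=p_{ji}$ such that, for $i\neq j$, $(i,j)$ is an arc of $V$ if and only if $\{i,j\}$ is an edge of $P$, and then $v_{ij}=p_{ij}-p_{ii}$. Let $2\le k\le N-1$ with $\mathcal F^k(V)\neq\emptyset$ and $\varphi_{k-1}-\varphi_k>\varphi_k-\varphi_{k+1}$ (considered satisfied when $\varphi_{k-1}=+\infty$). Then (a) for every $n\le k$, every forest $F\in\tilde{\mathcal F}^n(V)$ and every elementary set $\mathcal E$ of $\aleph_k$, the induced subgraph $F|_{\mathcal E}$ is a tree; and (b) $\varphi_n=\varphi^k_n$ for all $n\le k$.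
   Context: A forest is a digraph without directed circuits in which every vertex has outdegree $0$ or $1$; its trees are its weakly connected components; the root of a tree is its unique vertex of outdegree $0$; a digraph is a tree if it is a forest with one weakly connected component. $\mathcal F^k(V)$ is the set of spanning subgraphs of $V$ that are forests with exactly $k$ trees; $\Sigma^F=\sum_{(i,j)\in\mathcal A F}v_{ij}$; $\varphi_k=\min_{F\in\mathcal F^k(V)}\Sigma^F$ ($+\infty$ if empty); $\tilde{\mathcal F}^k(V)=\{F\in\mathcal F^k(V):\Sigma^F=\varphi_k\}$. $\aleph_k$ is the algebra of subsets of $\mathcal N$ generated by the vertex sets of all trees of all forests in $\tilde{\mathcal F}^k(V)$; its elementary sets are its minimal nonempty members. $H|_{\mathcal S}$ is the subgraph of $H$ induced by $\mathcal S$. The weighted condensation of level $k$, $V^k$, is the digraph whose vertices are the elementary sets of $\aleph_k$; for distinct elementary sets $\mathcal X,\mathcal Y$ there is an arc $(\mathcal X,\mathcal Y)$ iff there exist $i\in\mathcal X$, $j\in\mathcal Y$ with $(i,j)\in\mathcal A V$ and $i$ the root of at least one spanning tree of $V|_{\mathcal X}$, and then its weight is $v^k_{\mathcal X\mathcal Y}=\min_{i\in\mathcal X,\,j\in\mathcal Y}\big(\min_{T}\Sigma^{T}+v_{ij}\big)$, the inner minimum over spanning trees $T$ of $V|_{\mathcal X}$ with root $i$ (pairs for which no such $T$ or no arc $(i,j)$ exists being omitted). For a spanning forest $F$ of $V^k$, its weight is $\Sigma^F=\sum_{(\mathcal X,\mathcal Y)\in\mathcal A F}v^k_{\mathcal X\mathcal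 Y}+\sum_{\mathcal E}\min_{T}\sum_{(i,j)\in\mathcal A T}v_{ij}$, where the second sum runs over the elementary sets $\mathcal E$ that are roots of $F$ and the minimum is over all spanning trees $T$ of $V|_{\mathcal E}$. $\varphi^k_n=\min\{\Sigma^F: F$ a spanning subgraph of $V^k$ that is a forest with exactly $n$ trees$\}$. *)

theory Defs
  imports
    "HOL-Analysis.Sigma_Algebra"
    "HOL-Library.Extended_Real"
    "Graph_Theory.Graph_Theory"
begin

text \<open>
  Digraphs are finite. Arcs of a forest point towards its roots, and \<open>cycle\<close> is the
  library's notion of a directed circuit (loops included).
\<close>

definition directed_forest :: "('a, 'b) pre_digraph \<Rightarrow> bool" where
  "directed_forest F \<longleftrightarrow>
     fin_digraph F \<and> \<not> (\<exists>c. pre_digraph.cycle F c) \<and> (\<forall>x\<in>verts F. out_degree F x \<le> 1)"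

text \<open>
  The vertex sets of the weakly connected components: the strongly connected components of
  the symmetric closure.
\<close>

definition wcc_verts :: "('a, 'b) pre_digraph \<Rightarrow> 'a set set" where
  "wcc_verts G = pre_digraph.sccs_verts (with_proj (mk_symmetric G))"

definition directed_tree :: "('a, 'b) pre_digraph \<Rightarrow> bool" where
  "directed_tree T \<longleftrightarrow> directed_forest T \<and> card (wcc_verts T) = 1"

text \<open>
  A vertex has the same outdegree in a forest as in the component containing it, so for a
  forest these are exactly the roots of its trees.
\<close>

definition roots :: "('a, 'b) pre_digraph \<Rightarrow> 'a set" where
  "roots F = {x \<in> verts F. out_degree F x = 0}"

definition spanning_forests :: "('a, 'b) pre_digraph \<Rightarrow> nat \<Rightarrow> ('a, 'b) pre_digraph set" where
  "spanning_forests G k = {F. spanning F G \<and> directed_forest F \<and> card (wcc_verts F) = k}"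

definition spanning_trees :: "('a, 'b) pre_digraph \<Rightarrow> ('a, 'b) pre_digraph set" where
  "spanning_trees G = {T. spanning T G \<and> directed_tree T}"

definition arc_weight :: "'b weight_fun \<Rightarrow> ('a, 'b) pre_digraph \<Rightarrow> real" where
  "arc_weight v F = (\<Sum>e\<in>arcs F. v e)"

text \<open>
  A finite digraph has only finitely many spanning subgraphs, so the infima of extended reals
  below are minima, except that an infimum over the empty set is \<open>\<infinity>\<close>.
\<close>

definition phi :: "('a, 'b) pre_digraph \<Rightarrow> 'b weight_fun \<Rightarrow> nat \<Rightarrow> ereal" where
  "phi G v k = (INF F\<in>spanning_forests G k. ereal (arc_weight v F))"

definition min_forests ::
    "('a, 'b) pre_digraph \<Rightarrow> 'b weight_fun \<Rightarrow> nat \<Rightarrow> ('a, 'b) pre_digraph set" where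
  "min_forests G v k = {F \<in> spanning_forests G k. ereal (arc_weight v F) = phi G v k}"

definition aleph :: "('a, 'b) pre_digraph \<Rightarrow> 'b weight_fun \<Rightarrow> nat \<Rightarrow> 'a set set" where
  "aleph G v k = algebra (verts G) hull (\<Union>F\<in>min_forests G v k. wcc_verts F)"

definition elementary_sets :: "'a set set \<Rightarrow> 'a set set" where
  "elementary_sets M = {E \<in> M. E \<noteq> {} \<and> (\<forall>X\<in>M. X \<noteq> {} \<and> X \<subseteq> E \<longrightarrow> X = E)}"

definition rooted_spanning_trees ::
    "('a, 'b) pre_digraph \<Rightarrow> 'a \<Rightarrow> ('a, 'b) pre_digraph set" where
  "rooted_spanning_trees G i = {T \<in> spanning_trees G. i \<in> roots T}"

definition min_tree_weight :: "('a, 'b) pre_digraph \<Rightarrow> 'b weight_fun \<Rightarrow> ereal" where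
  "min_tree_weight G v = (INF T\<in>spanning_trees G. ereal (arc_weight v T))"

text \<open>The arcs \<open>(i, j)\<close> of \<open>V\<close> over which the weight of the condensed arc \<open>(X, Y)\<close> is minimised.\<close>

definition linking_arcs ::
    "'a pair_pre_digraph \<Rightarrow> 'a set \<Rightarrow> 'a set \<Rightarrow> ('a \<times> 'a) set" where
  "linking_arcs V X Y =
     {(i, j) \<in> parcs V. i \<in> X \<and> j \<in> Y \<and> rooted_spanning_trees (with_proj V \<restriction> X) i \<noteq> {}}"

definition condensation ::
    "'a pair_pre_digraph \<Rightarrow> ('a \<times> 'a) weight_fun \<Rightarrow> nat \<Rightarrow> 'a set pair_pre_digraph" where
  "condensation V v k =
     (let \<E> = elementary_sets (aleph V v k) in
      \<lparr> pverts = \<E>, parcs = {(X, Y) \<in> \<E> \<times> \<E>. X \<noteq> Y \<and> linking_arcs V X Y \<noteq> {}} \<rparr>)"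

text \<open>
  Only meaningful on arcs of the condensation, where both minima are taken over finite
  nonempty sets.
\<close>

definition condensation_weight ::
    "'a pair_pre_digraph \<Rightarrow> ('a \<times> 'a) weight_fun \<Rightarrow> ('a set \<times> 'a set) weight_fun" where
  "condensation_weight V v = (\<lambda>(X, Y).
     (MIN (i, j)\<in>linking_arcs V X Y.
        (MIN T\<in>rooted_spanning_trees (with_proj V \<restriction> X) i. arc_weight v T) + v (i, j)))"

definition condensation_forest_weight ::
    "'a pair_pre_digraph \<Rightarrow> ('a \<times> 'a) weight_fun \<Rightarrow>
     ('a set, 'a set \<times> 'a set) pre_digraph \<Rightarrow> ereal" where
  "condensation_forest_weight V v F =
     ereal (arc_weight (condensation_weight V v) F)
       + (\<Sum>E\<in>roots F. min_tree_weight (with_proj V \<restriction> E) v)"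

definition condensation_phi ::
    "'a pair_pre_digraph \<Rightarrow> ('a \<times> 'a) weight_fun \<Rightarrow> nat \<Rightarrow> nat \<Rightarrow> ereal" where
  "condensation_phi V v k n =
     (INF F\<in>spanning_forests (condensation V v k) n. condensation_forest_weight V v F)"

text \<open>
  \<open>Ed\<close> is the edge set of the non-directed graph; \<open>p i j\<close> with \<open>i \<noteq> j\<close> is only relevant
  when \<open>{i, j}\<close> is an edge.
\<close>

definition potential_weights :: "'a pair_pre_digraph \<Rightarrow> ('a \<times> 'a) weight_fun \<Rightarrow> bool" where
  "potential_weights V v \<longleftrightarrow>
     (\<exists>Ed p.
        (\<forall>e\<in>Ed. \<exists>i\<in>pverts V. \<exists>j\<in>pverts V. i \<noteq> j \<and> e = {i, j}) \<and>
        (\<forall>i j. {i, j} \<in> Ed \<longrightarrow> p i j = p j i) \<and>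
        (\<forall>i\<in>pverts V. \<forall>j\<in>pverts V. i \<noteq> j \<longrightarrow>
           ((i, j) \<in> parcs V \<longleftrightarrow> {i, j} \<in> Ed) \<and>
           ((i, j) \<in> parcs V \<longrightarrow> v (i, j) = p i j - p i i)))"

end

theory Submission
  imports Defs
begin

text \<open>
  Join every vertex \<open>i\<close> to an extra vertex \<open>r\<close> by an edge of weight \<open>p i i\<close>. For potential
  weights the orientation of a forest is irrelevant: forests with \<open>n\<close> trees correspond, up to a
  constant in the weight, to spanning trees of the extended graph with degree \<open>n\<close> at \<open>r\<close>.
  Symmetric exchange makes \<open>\<phi>\<close> convex. If \<open>F\<close> is minimal of level \<open>k\<close>, \<open>G\<close> is minimal of level
  \<open>n \<le> k\<close> and \<open>e\<close> is an edge of \<open>F - G\<close> not at \<open>r\<close>, then the strict gap at \<open>k\<close> prevents \<open>e\<close>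
  from being exchanged for an edge at \<open>r\<close>, so the exchange preserves both levels and
  minimality. Hence every minimal forest of level \<open>n\<close> contains a minimal forest of level \<open>k\<close>,
  and for (a) it suffices to treat \<open>n = k\<close>.

  The elementary sets are the classes of vertices that no minimal forest of level \<open>k\<close>
  separates. For \<open>x\<close>, \<open>y\<close> in one class, exchanges also show that the path of \<open>F\<close> from \<open>x\<close> to
  \<open>y\<close> stays in the component of \<open>x\<close> in every other minimal forest, hence in the class.
  For (b), a forest that restricts to a tree on each elementary set is the same as a forest
  of the condensation together with a tree on each elementary set.
\<close>

section \<open>Undirected connectivity\<close>

text \<open>Reflexive on the whole type, so no vertex set is carried along; a point on no edge is
  linked only to itself.\<close>

definition linked :: "'a set set \<Rightarrow> 'a rel" where
  "linked B = {(a, b). {a, b} \<in> B}\<^sup>*"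

lemma linked_refl [simp]: "(x, x) \<in> linked B"
  by (simp add: linked_def)

lemma linked_trans: "(x, y) \<in> linked B \<Longrightarrow> (y, z) \<in> linked B \<Longrightarrow> (x, z) \<in> linked B"
  by (simp add: linked_def)

lemma linked_edge: "{x, y} \<in> B \<Longrightarrow> (x, y) \<in> linked B"
  by (auto simp: linked_def)

lemma linked_sym: "(x, y) \<in> linked B \<Longrightarrow> (y, x) \<in> linked B"
proof -
  have "sym {(a, b). {a, b} \<in> B}"
    by (auto simp: sym_def insert_commute)
  then show "(x, y) \<in> linked B \<Longrightarrow> (y, x) \<in> linked B"
    unfolding linked_def by (meson sym_rtrancl symD)
qed

lemma linked_mono: "B \<subseteq> C \<Longrightarrow> (x, y) \<in> linked B \<Longrightarrow> (x, y) \<in> linked C"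
  unfolding linked_def by (erule rtrancl_mono[THEN subsetD, rotated]) auto

lemma linked_induct [consumes 1, case_names refl step]:
  assumes "(x, y) \<in> linked B" and "P x"
    and "\<And>y z. (x, y) \<in> linked B \<Longrightarrow> {y, z} \<in> B \<Longrightarrow> P y \<Longrightarrow> P z"
  shows "P y"
  using assms unfolding linked_def by (induction rule: rtrancl_induct) auto

lemma linked_closed:
  assumes "(x, y) \<in> linked B" and "x \<in> S" and "\<And>a b. {a, b} \<in> B \<Longrightarrow> a \<in> S \<Longrightarrow> b \<in> S"
  shows "y \<in> S"
  using assms by (induction rule: linked_induct) auto

lemma linked_subI:
  assumes "(x, y) \<in> linked B" and "\<And>a b. {a, b} \<in> B \<Longrightarrow> (a, b) \<in> linked C"
  shows "(x, y) \<in> linked C"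
  using assms by (induction rule: linked_induct) (auto intro: linked_trans)

text \<open>A new edge merges at most the components of its two ends, so one passage through it
  suffices for every new link.\<close>

lemma linked_insert_cases:
  assumes "(x, y) \<in> linked (insert {u, v} D)"
  shows "(x, y) \<in> linked D \<or> (x, u) \<in> linked D \<and> (v, y) \<in> linked D
    \<or> (x, v) \<in> linked D \<and> (u, y) \<in> linked D"
  using assms
proof (induction rule: linked_induct)
  case refl
  then show ?case by simp
next
  case (step y z)
  from step(2) consider "{y, z} \<in> D" | "y = u" "z = v" | "y = v" "z = u"
    by (auto simp: doubleton_eq_iff)
  then show ?case
  proof cases
    case 1
    then have "(y, z) \<in> linked D"
      by (rule linked_edge)
    with step(3) show ?thesis
      by (blast intro: linked_trans)
  qed (use step(3) in auto)
qed

text \<open>Avoids paths: an edge lies on a circuit iff its ends stay linked without it. The case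
  \<open>u = v\<close> also rules out singletons, by reflexivity.\<close>

definition circuit_free :: "'a set set \<Rightarrow> bool" where
  "circuit_free B \<longleftrightarrow> (\<forall>u v. {u, v} \<in> B \<longrightarrow> (u, v) \<notin> linked (B - {{u, v}}))"

definition doubletons :: "'a set set \<Rightarrow> bool" where
  "doubletons B \<longleftrightarrow> (\<forall>e\<in>B. \<exists>u v. e = {u, v})"

lemma circuit_free_subset: "circuit_free B \<Longrightarrow> A \<subseteq> B \<Longrightarrow> circuit_free A"
  unfolding circuit_free_def using linked_mono[of "A - {e}" "B - {e}" for e] by blast

lemma linked_Diff_edge:
  assumes "(x, y) \<in> linked B" and "(x, y) \<notin> linked (B - {{u, v}})"
  shows "(x, u) \<in> linked (B - {{u, v}}) \<and> (v, y) \<in> linked (B - {{u, v}})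
    \<or> (x, v) \<in> linked (B - {{u, v}}) \<and> (u, y) \<in> linked (B - {{u, v}})"
proof -
  have "(x, y) \<in> linked (insert {u, v} (B - {{u, v}}))"
    by (rule linked_mono[OF _ assms(1)]) auto
  from linked_insert_cases[OF this] assms(2) show ?thesis
    by blast
qed

text \<open>A minimal subset \<open>P\<close> of \<open>A\<close> that links \<open>x\<close> and
  \<open>y\<close> plays the role of the path between them. It is not contained in \<open>Q\<close>,
  and any of its edges outside \<open>Q\<close> separates \<open>x\<close> from \<open>y\<close>
  because paths in a circuit-free set are unique.\<close>

lemma separating_edge:
  assumes "circuit_free A" "doubletons A" "finite A"
    and xy: "(x, y) \<in> linked A" and Q: "(x, y) \<notin> linked Q"
  obtains g where "g \<in> A" "g \<notin> Q" "(x, y) \<notin> linked (A - {g})"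
proof -
  define \<P> where "\<P> = {P. P \<subseteq> A \<and> (x, y) \<in> linked P}"
  have "finite \<P>" "\<P> \<noteq> {}"
    using assms by (auto simp: \<P>_def)
  then obtain P where P: "P \<in> \<P>" and min: "\<And>P'. P' \<in> \<P> \<Longrightarrow> P' \<subseteq> P \<Longrightarrow> P' = P"
    using finite_has_minimal[of \<P>] by metis
  have "\<not> P \<subseteq> Q"
    using P Q linked_mono[of P Q x y] by (auto simp: \<P>_def)
  then obtain g where g: "g \<in> P" "g \<notin> Q"
    by blast
  with P have gA: "g \<in> A"
    by (auto simp: \<P>_def)
  then obtain u v where uv: "g = {u, v}"
    using assms(2) by (auto simp: doubletons_def)
  have Pg: "(x, y) \<notin> linked (P - {g})"
    using min[of "P - {g}"] g P by (auto simp: \<P>_def)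
  \<comment> \<open>Otherwise this second connection together with the rest of \<open>P\<close>
    links the ends of \<open>g\<close> without \<open>g\<close>.\<close>
  have "(x, y) \<notin> linked (A - {g})"
  proof
    assume *: "(x, y) \<in> linked (A - {g})"
    have up: "(a, b) \<in> linked (A - {g})" if "(a, b) \<in> linked (P - {g})" for a b
      by (rule linked_mono[OF _ that]) (use P in \<open>auto simp: \<P>_def\<close>)
    have "(x, y) \<in> linked P"
      using P by (simp add: \<P>_def)
    from linked_Diff_edge[OF this, of u v] Pg up have
      "(x, u) \<in> linked (A - {g}) \<and> (v, y) \<in> linked (A - {g})
        \<or> (x, v) \<in> linked (A - {g}) \<and> (u, y) \<in> linked (A - {g})"
      unfolding uv by blast
    with * have "(u, v) \<in> linked (A - {g})"
      by (meson linked_sym linked_trans)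
    then show False
      using assms(1) gA by (auto simp: circuit_free_def uv)
  qed
  with g gA that show thesis by blast
qed

text \<open>\<open>f\<close> is the parent function of a breadth-first search tree and \<open>d\<close> the distance from \<open>r\<close>.\<close>

lemma linked_parent:
  assumes "\<And>x. x \<in> W \<Longrightarrow> (r, x) \<in> linked B"
  obtains f and d :: "'a \<Rightarrow> nat" where
    "\<And>x. x \<in> W \<Longrightarrow> x \<noteq> r \<Longrightarrow> {x, f x} \<in> B \<and> d (f x) < d x"
    and "inj_on (\<lambda>x. {x, f x}) (W - {r})"
proof -
  let ?R = "{(a, b). {a, b} \<in> B}"
  define d where "d x = (LEAST n. (r, x) \<in> ?R ^^ n)" for x
  have "\<exists>z. {x, z} \<in> B \<and> d z < d x" if "x \<in> W" "x \<noteq> r" for x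
  proof -
    have "\<exists>n. (r, x) \<in> ?R ^^ n"
      using assms[OF that(1)] by (simp add: linked_def rtrancl_power)
    then have *: "(r, x) \<in> ?R ^^ d x"
      unfolding d_def by (rule LeastI_ex)
    moreover have "d x \<noteq> 0"
    proof
      assume "d x = 0"
      with * have "(r, x) \<in> ?R ^^ 0" by metis
      with that(2) show False by simp
    qed
    ultimately obtain m where m: "d x = Suc m" and "(r, x) \<in> ?R ^^ Suc m"
      by (metis not0_implies_Suc)
    then obtain z where z: "(r, z) \<in> ?R ^^ m" "{z, x} \<in> B"
      by auto
    have "d z \<le> m"
      unfolding d_def by (rule Least_le) (rule z(1))
    with m z(2) show ?thesis
      by (auto simp: insert_commute)
  qed
  then obtain f where f: "\<And>x. x \<in> W \<Longrightarrow> x \<noteq> r \<Longrightarrow> {x, f x} \<in> B \<and> d (f x) < d x"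
    by metis
  moreover have "inj_on (\<lambda>x. {x, f x}) (W - {r})"
  proof (rule inj_onI)
    fix x y
    assume *: "x \<in> W - {r}" "y \<in> W - {r}" "{x, f x} = {y, f y}"
    \<comment> \<open>If the vertices differed, each would be the parent of the other, and
      \<open>d\<close> would decrease both ways.\<close>
    then show "x = y"
      using f[of x] f[of y] by (auto simp: doubleton_eq_iff)
  qed
  ultimately show thesis
    by (rule that)
qed

section \<open>Spanning trees of minimal weight with prescribed degree at a vertex\<close>

lemma sum_Diff_insert:
  assumes "finite A" "a \<in> A" "b \<notin> A"
  shows "sum f (insert b (A - {a})) = sum f A - f a + (f b :: real)"
  using assms by (simp add: sum_diff1)

lemma card_Diff_insert:
  assumes "finite A" "a \<in> A" "b \<notin> A"
  shows "card (insert b (A - {a})) = card A"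
proof -
  have "card A > 0" using assms card_gt_0_iff by blast
  then show ?thesis using assms by (simp add: card_Diff_singleton)
qed

locale rooted_edge_weights =
  fixes W :: "'a set" and r :: 'a and EE :: "'a set set" and w :: "'a set \<Rightarrow> real"
  assumes finite_W: "finite W" and r_in_W: "r \<in> W"
    and edges: "\<And>e. e \<in> EE \<Longrightarrow> \<exists>u\<in>W. \<exists>v\<in>W. u \<noteq> v \<and> e = {u, v}"
begin

text \<open>Acyclicity is replaced by the edge count, which is easy to maintain under swaps;
  \<open>sptree_circuit_free\<close> recovers it.\<close>

definition sptree :: "'a set set \<Rightarrow> bool" where
  "sptree B \<longleftrightarrow> B \<subseteq> EE \<and> (\<forall>x\<in>W. (r, x) \<in> linked B) \<and> card B = card (W - {r})"

text \<open>Deleting \<open>r\<close> from a spanning tree leaves a forest with edge set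
  \<open>nr B\<close>; each of its trees hangs on \<open>r\<close> by one edge, so it has
  \<open>rdeg B\<close> trees.\<close>

abbreviation (input) nr :: "'a set set \<Rightarrow> 'a set set" where
  "nr B \<equiv> {e \<in> B. r \<notin> e}"

abbreviation (input) rdeg :: "'a set set \<Rightarrow> nat" where
  "rdeg B \<equiv> card {e \<in> B. r \<in> e}"

definition trees :: "nat \<Rightarrow> 'a set set set" where
  "trees m = {B. sptree B \<and> rdeg B = m}"

definition min_trees :: "nat \<Rightarrow> 'a set set set" where
  "min_trees m = {B \<in> trees m. \<forall>C\<in>trees m. sum w B \<le> sum w C}"

lemma finite_EE: "finite EE"
proof (rule finite_subset)
  show "EE \<subseteq> Pow W" using edges by fastforce
qed (use finite_W in auto)

lemma sptree_finite: "sptree B \<Longrightarrow> finite B"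
  using finite_EE finite_subset by (auto simp: sptree_def)

lemma doubletons_sub: "B \<subseteq> EE \<Longrightarrow> doubletons B"
  using edges unfolding doubletons_def by blast

lemma sptree_doubletons: "sptree B \<Longrightarrow> doubletons B"
  by (rule doubletons_sub) (simp add: sptree_def)

text \<open>Each vertex other than \<open>r\<close> owns the edge to its parent, and these edges are
  distinct.\<close>

lemma card_ge_if_linked:
  assumes "\<And>x. x \<in> W \<Longrightarrow> (r, x) \<in> linked B" "finite B"
  shows "card (W - {r}) \<le> card B"
proof -
  obtain f and d :: "'a \<Rightarrow> nat" where fd: "\<And>x. x \<in> W \<Longrightarrow> x \<noteq> r \<Longrightarrow> {x, f x} \<in> B \<and> d (f x) < d x"
    "inj_on (\<lambda>x. {x, f x}) (W - {r})"
    using linked_parent[of W r B, OF assms(1)] by blast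
  then have "(\<lambda>x. {x, f x}) ` (W - {r}) \<subseteq> B" by auto
  with fd(2) assms(2) show ?thesis
    by (metis card_image card_mono)
qed

text \<open>The parent edges are distinct and as many as the edges of \<open>B\<close>, so they
  exhaust \<open>B\<close>.\<close>

lemma sptree_orientation:
  assumes "sptree B"
  obtains f and d :: "'a \<Rightarrow> nat" where
    "\<And>x. x \<in> W \<Longrightarrow> x \<noteq> r \<Longrightarrow> d (f x) < d x"
    and "inj_on (\<lambda>x. {x, f x}) (W - {r})" and "B = (\<lambda>x. {x, f x}) ` (W - {r})"
proof -
  have "(r, x) \<in> linked B" if "x \<in> W" for x using assms that by (auto simp: sptree_def)
  then obtain f and d :: "'a \<Rightarrow> nat" where
    fd: "\<And>x. x \<in> W \<Longrightarrow> x \<noteq> r \<Longrightarrow> {x, f x} \<in> B \<and> d (f x) < d x"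
    "inj_on (\<lambda>x. {x, f x}) (W - {r})"
    using linked_parent[of W r B] by blast
  have sub: "(\<lambda>x. {x, f x}) ` (W - {r}) \<subseteq> B" using fd by auto
  have "card ((\<lambda>x. {x, f x}) ` (W - {r})) = card B"
    using fd(2) assms by (simp add: card_image sptree_def)
  then have "(\<lambda>x. {x, f x}) ` (W - {r}) = B"
    using sub sptree_finite[OF assms] by (intro card_subset_eq)
  then show thesis
    using fd by (intro that[of d f]) auto
qed

text \<open>An edge whose ends stay linked without it could be dropped, leaving a connected graph
  with too few edges for \<open>card_ge_if_linked\<close>.\<close>

lemma sptree_circuit_free:
  assumes "sptree B"
  shows "circuit_free B"
  unfolding circuit_free_def
proof (intro allI impI notI)
  fix u v assume uv: "{u, v} \<in> B" "(u, v) \<in> linked (B - {{u, v}})"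
  have "(r, x) \<in> linked (B - {{u, v}})" if "x \<in> W" for x
  proof (rule linked_subI)
    show "(r, x) \<in> linked B" using assms that by (simp add: sptree_def)
    fix a b assume "{a, b} \<in> B"
    then show "(a, b) \<in> linked (B - {{u, v}})"
      using uv(2) linked_sym[OF uv(2)] by (cases "{a, b} = {u, v}") (auto simp: doubleton_eq_iff intro: linked_edge)
  qed
  then have "card (W - {r}) \<le> card (B - {{u, v}})"
    using sptree_finite[OF assms] by (intro card_ge_if_linked) auto
  also have "\<dots> < card B"
    using uv(1) sptree_finite[OF assms] by (meson card_Diff1_less)
  finally show False using assms by (simp add: sptree_def)
qed

lemma sptree_linked:
  assumes "sptree B" "x \<in> W" "y \<in> W"
  shows "(x, y) \<in> linked B"
  using assms unfolding sptree_def by (meson linked_sym linked_trans)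

text \<open>The last hypothesis says that \<open>g\<close> lies on the path of \<open>B\<close> from
  \<open>a\<close> to \<open>b\<close>, so the new edge reconnects the two parts left by deleting
  \<open>g\<close>.\<close>

lemma sptree_swap:
  assumes B: "sptree B" and e: "{a, b} \<in> EE" "{a, b} \<notin> B" and g: "g \<in> B"
    and ab: "(a, b) \<notin> linked (B - {g})"
  shows "sptree (insert {a, b} (B - {g}))"
proof -
  from edges[OF e(1)] have W: "a \<in> W" "b \<in> W" by (auto simp: doubleton_eq_iff)
  obtain u v where uv: "g = {u, v}"
    using sptree_doubletons[OF B] g by (auto simp: doubletons_def)
  let ?C = "insert {a, b} (B - {g})"
  have up: "(x, y) \<in> linked ?C" if "(x, y) \<in> linked (B - {g})" for x y
    by (rule linked_mono[OF _ that]) auto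
  have ab': "(a, b) \<in> linked ?C" by (rule linked_edge) simp
  from linked_Diff_edge[OF sptree_linked[OF B W], of u v] ab up
  have "(a, u) \<in> linked ?C \<and> (v, b) \<in> linked ?C \<or> (a, v) \<in> linked ?C \<and> (u, b) \<in> linked ?C"
    unfolding uv by blast
  then have uv': "(u, v) \<in> linked ?C"
    using ab' by (meson linked_sym linked_trans)
  have "(r, x) \<in> linked ?C" if "x \<in> W" for x
  proof (rule linked_subI)
    show "(r, x) \<in> linked B" using B that by (simp add: sptree_def)
    fix c d assume "{c, d} \<in> B"
    then show "(c, d) \<in> linked ?C"
      using uv' linked_sym[OF uv'] by (cases "{c, d} = g") (auto simp: uv doubleton_eq_iff intro: linked_edge)
  qed
  then show ?thesis
    using B e g sptree_finite[OF B] card_Diff_insert[OF _ g e(2)] by (auto simp: sptree_def)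
qed

text \<open>Deleting \<open>e\<close> splits \<open>F\<close> into two parts, and the path of
  \<open>G\<close> between the ends of \<open>e\<close> must cross from one to the other. A crossing
  edge \<open>g\<close> of that path serves both swaps: it rejoins the parts of \<open>F\<close>,
  and \<open>e\<close> closes the gap it leaves in \<open>G\<close>.\<close>

lemma symmetric_exchange:
  assumes F: "sptree F" and G: "sptree G" and e: "e \<in> F" "e \<notin> G"
  obtains g where "g \<in> G" "g \<notin> F" "sptree (insert g (F - {e}))" "sptree (insert e (G - {g}))"
proof -
  have eE: "e \<in> EE" using F e by (auto simp: sptree_def)
  then obtain a b where ab: "a \<in> W" "b \<in> W" "e = {a, b}" using edges by blast
  define S where "S = {x. (a, x) \<in> linked (F - {e})}"
  have "b \<notin> S"
    using sptree_circuit_free[OF F] e ab by (auto simp: S_def circuit_free_def)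
  \<comment> \<open>The edges of \<open>G\<close> that do not cross the cut. They cannot lead out of
    \<open>S\<close>, so \<open>separating_edge\<close> delivers a crossing edge of the
    path.\<close>
  define Q where "Q = {g \<in> G. \<not> (\<exists>c d. g = {c, d} \<and> c \<in> S \<and> d \<notin> S)}"
  have "(a, b) \<notin> linked Q"
  proof
    assume "(a, b) \<in> linked Q"
    then have "b \<in> S"
      by (rule linked_closed) (auto simp: S_def Q_def)
    with \<open>b \<notin> S\<close> show False ..
  qed
  then obtain g where g: "g \<in> G" "g \<notin> Q" "(a, b) \<notin> linked (G - {g})"
    using separating_edge[OF sptree_circuit_free[OF G] sptree_doubletons[OF G] sptree_finite[OF G]
      sptree_linked[OF G ab(1,2)]] by blast
  then obtain c d where cd: "g = {c, d}" "c \<in> S" "d \<notin> S"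
    by (auto simp: Q_def)
  have cd': "(c, d) \<notin> linked (F - {e})"
    using cd(2,3) by (auto simp: S_def intro: linked_trans)
  then have "g \<notin> F"
    using g(1) e(2) unfolding cd(1) by (metis DiffI linked_edge singletonD)
  moreover have "sptree (insert g (F - {e}))"
    using sptree_swap[OF F _ _ e(1) cd'] G g(1) \<open>g \<notin> F\<close> by (auto simp: cd(1) sptree_def)
  moreover have "sptree (insert e (G - {g}))"
    using sptree_swap[OF G _ _ g(1)] eE e(2) g(3) by (auto simp: ab(3))
  ultimately show thesis
    using g(1) that by blast
qed

lemma exchange_sum:
  assumes "sptree F" "sptree G" "e \<in> F" "e \<notin> G" "g \<in> G" "g \<notin> F"
  shows "sum w (insert g (F - {e})) + sum w (insert e (G - {g})) = sum w F + sum w G"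
  using sum_Diff_insert[OF sptree_finite[OF assms(1)] assms(3,6), of w]
    sum_Diff_insert[OF sptree_finite[OF assms(2)] assms(5,4), of w] by simp

text \<open>The additive form avoids truncated subtraction.\<close>

lemma exchange_rdeg:
  assumes B: "sptree B" and "g \<in> B" "e \<notin> B"
  shows "rdeg (insert e (B - {g})) + (if r \<in> g then 1 else 0) = rdeg B + (if r \<in> e then 1 else 0)"
proof -
  have fin: "finite {e \<in> B. r \<in> e}" using sptree_finite[OF B] by simp
  have *: "{x \<in> insert e (B - {g}). r \<in> x}
    = (if r \<in> e then insert e else id) (if r \<in> g then {x \<in> B. r \<in> x} - {g} else {x \<in> B. r \<in> x})"
    by auto
  have "r \<in> g \<Longrightarrow> card {x \<in> B. r \<in> x} > 0"
    using fin assms(2) card_gt_0_iff by blast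
  then show ?thesis
    unfolding * using fin assms(2,3) by (auto simp: card_insert_if card_Diff_singleton_if)
qed

section \<open>Minimal trees with prescribed degree at \<open>r\<close>, and convexity of their
  weight\<close>

lemma finite_trees: "finite (trees m)"
proof (rule finite_subset)
  show "trees m \<subseteq> Pow EE" by (auto simp: trees_def sptree_def)
qed (use finite_EE in auto)

lemma min_trees_nonempty:
  assumes "trees m \<noteq> {}"
  shows "min_trees m \<noteq> {}"
proof -
  from arg_min_if_finite[OF finite_trees assms, of "sum w"] show ?thesis
    by (auto simp: min_trees_def not_less intro!: exI[of _ "arg_min_on (sum w) (trees m)"])
qed

lemma min_treesD:
  assumes "F \<in> min_trees m"
  shows "F \<in> trees m" "sptree F" "finite F" "rdeg F = m"
  using assms sptree_finite by (auto simp: min_trees_def trees_def)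

lemma min_trees_le: "F \<in> min_trees m \<Longrightarrow> C \<in> trees m \<Longrightarrow> sum w F \<le> sum w C"
  by (auto simp: min_trees_def)

lemma min_treesI: "C \<in> trees m \<Longrightarrow> F \<in> min_trees m \<Longrightarrow> sum w C \<le> sum w F \<Longrightarrow> C \<in> min_trees m"
  by (auto simp: min_trees_def intro: order_trans)

text \<open>The measure that drives the extremal choices below: replacing an edge outside
  \<open>G\<close> by one of \<open>G\<close> brings \<open>F\<close> closer to
  \<open>G\<close>.\<close>

lemma swap_card_less:
  assumes "finite F" "e \<in> F" "e \<notin> G" "g \<in> G"
  shows "card (insert g (F - {e}) - G) < card (F - G)"
proof -
  have "insert g (F - {e}) - G = (F - G) - {e}"
    using assms(4) by auto
  then show ?thesis
    using assms(1,2,3) by (metis DiffI card_Diff1_less finite_Diff)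
qed

text \<open>Take minimal \<open>A\<close> and \<open>B\<close> with \<open>B - A\<close> as small as
  possible. As \<open>B\<close> has the larger degree at \<open>r\<close>, it has an edge
  \<open>e\<close> there outside \<open>A\<close>. Its partner in the exchange cannot be at
  \<open>r\<close> too, since then the pair could be brought closer. So the exchange moves each
  level one step towards the other.\<close>

lemma trees_balance:
  assumes "trees a \<noteq> {}" "trees b \<noteq> {}" "a < b"
  obtains A B A' B' where "A \<in> min_trees a" "B \<in> min_trees b"
    "A' \<in> trees (a + 1)" "B' \<in> trees (b - 1)" "sum w A' + sum w B' = sum w A + sum w B"
proof -
  let ?P = "\<lambda>p. fst p \<in> min_trees a \<and> snd p \<in> min_trees b"
  let ?m = "\<lambda>p. card (snd p - fst p)"
  obtain A0 B0 where "A0 \<in> min_trees a" "B0 \<in> min_trees b"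
    using min_trees_nonempty[OF assms(1)] min_trees_nonempty[OF assms(2)] by blast
  then have "?P (A0, B0)" by simp
  from ex_has_least_nat[of ?P, OF this, of ?m] obtain p where p: "?P p" "\<And>q. ?P q \<Longrightarrow> ?m p \<le> ?m q"
    by blast
  obtain A B where AB: "p = (A, B)" by (cases p)
  have A: "A \<in> min_trees a" and B: "B \<in> min_trees b"
    and least: "\<And>B'. B' \<in> min_trees b \<Longrightarrow> card (B - A) \<le> card (B' - A)"
    using p(1) p(2)[of "(A, B')" for B'] by (auto simp: AB)
  note A' = min_treesD[OF A] and B' = min_treesD[OF B]
  have "\<not> {e \<in> B. r \<in> e} \<subseteq> {e \<in> A. r \<in> e}"
    using card_mono[of "{e \<in> A. r \<in> e}" "{e \<in> B. r \<in> e}"] A' B' assms(3) by auto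
  then obtain e where e: "e \<in> B" "e \<notin> A" "r \<in> e" by blast
  obtain g where g: "g \<in> A" "g \<notin> B" "sptree (insert g (B - {e}))" "sptree (insert e (A - {g}))"
    using symmetric_exchange[OF B'(2) A'(2) e(1,2)] by blast
  have sum: "sum w (insert g (B - {e})) + sum w (insert e (A - {g})) = sum w B + sum w A"
    by (rule exchange_sum[OF B'(2) A'(2) e(1,2) g(1,2)])
  note degB = exchange_rdeg[OF B'(2) e(1) g(2)] and degA = exchange_rdeg[OF A'(2) g(1) e(2)]
  show thesis
  proof (cases "r \<in> g")
    \<comment> \<open>Both levels are kept. The total weight is unchanged and the new tree of level
      \<open>a\<close> is no lighter than \<open>A\<close>, so the new tree of level
      \<open>b\<close> is minimal again.\<close>
    case True
    have BB: "insert g (B - {e}) \<in> trees b" and AA: "insert e (A - {g}) \<in> trees a"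
      using degB degA True e g A' B' by (auto simp: trees_def)
    have "insert g (B - {e}) \<in> min_trees b"
      using min_treesI[OF BB B] min_trees_le[OF A AA] sum by simp
    from least[OF this] swap_card_less[OF B'(3) e(1,2) g(1)] show ?thesis
      by simp
  next
    case False
    have "insert g (B - {e}) \<in> trees (b - 1)" "insert e (A - {g}) \<in> trees (a + 1)"
      using degB degA False e g A' B' by (auto simp: trees_def)
    with that[OF A B] sum show ?thesis
      by (simp add: add.commute)
  qed
qed

text \<open>Balancing levels \<open>n\<close> and \<open>n + 2\<close> puts both new trees on level
  \<open>n + 1\<close>.\<close>

lemma min_trees_convex:
  assumes "A \<in> min_trees n" "C \<in> min_trees (n + 1)" "B \<in> min_trees (n + 2)"
  shows "2 * sum w C \<le> sum w A + sum w B"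
proof -
  have "trees n \<noteq> {}" "trees (n + 2) \<noteq> {}"
    using assms min_treesD(1) by blast+
  then obtain A1 B1 A' B' where *: "A1 \<in> min_trees n" "B1 \<in> min_trees (n + 2)"
    "A' \<in> trees (n + 1)" "B' \<in> trees (n + 2 - 1)" "sum w A' + sum w B' = sum w A1 + sum w B1"
    using trees_balance[of n "n + 2"] by (metis less_add_same_cancel1 pos2)
  have "sum w C \<le> sum w A'" "sum w C \<le> sum w B'"
    using min_trees_le[OF assms(2)] *(3,4) by simp_all
  moreover have "sum w A1 \<le> sum w A" "sum w B1 \<le> sum w B"
    using *(1,2) assms min_trees_le min_treesD(1) by blast+
  ultimately show ?thesis
    using *(5) by simp
qed

text \<open>The gap condition on \<open>phi\<close>, multiplied out. Quantifying over trees makes it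
  vacuous when level \<open>k - 1\<close> or \<open>k + 1\<close> is empty, which covers infinite
  minima; \<open>1 \<le> k\<close> keeps \<open>k - 1\<close> from truncating.\<close>

definition strictly_convex_at :: "nat \<Rightarrow> bool" where
  "strictly_convex_at k \<longleftrightarrow> 1 \<le> k \<and>
    (\<forall>A\<in>trees (k - 1). \<forall>F\<in>min_trees k. \<forall>B\<in>trees (k + 1). 2 * sum w F < sum w A + sum w B)"

text \<open>By convexity the drop in minimal weight from level \<open>n - 1\<close> to level
  \<open>n\<close> is at least the drop from \<open>k - 1\<close> to \<open>k\<close>, so it too
  exceeds the drop from \<open>k\<close> to \<open>k + 1\<close>. The induction descends from
  \<open>k\<close>.\<close>

lemma strictly_convex_below:
  assumes strict: "strictly_convex_at k" and "1 \<le> n" "n \<le> k"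
    and F: "F \<in> min_trees k" and B: "B \<in> trees (k + 1)"
    and "A \<in> trees (n - 1)" "G \<in> min_trees n"
  shows "sum w G + sum w F < sum w A + sum w B"
  using assms(3,2,6,7)
proof (induction arbitrary: A G rule: inc_induct)
  case base
  have "sum w G \<le> sum w F"
    using min_trees_le[OF base(3)] min_treesD(1)[OF F] .
  then show ?case
    using strict F B base(2) unfolding strictly_convex_at_def by fastforce
next
  case (step n)
  \<comment> \<open>\<open>trees_balance\<close> between levels \<open>n\<close> and
    \<open>k + 1\<close> serves to show that level \<open>n + 1\<close> is not empty.\<close>
  have "trees n \<noteq> {}" "trees (k + 1) \<noteq> {}" "trees (n - 1) \<noteq> {}"
    using step.prems min_treesD(1) B by blast+
  then obtain A0 G1 where A0: "A0 \<in> min_trees (n - 1)" and G1: "G1 \<in> min_trees (n + 1)"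
    using trees_balance[of n "k + 1"] step.hyps min_trees_nonempty
    by (metis empty_iff equals0I less_SucI Suc_eq_plus1)
  have "2 * sum w G \<le> sum w A0 + sum w G1"
    using min_trees_convex[of A0 "n - 1" G G1] A0 G1 step.prems by simp
  moreover have "sum w A0 \<le> sum w A"
    using min_trees_le[OF A0] step.prems by simp
  moreover have "sum w G1 + sum w F < sum w G + sum w B"
    using step.IH[of G G1] G1 min_treesD(1)[OF step.prems(3)] by simp
  ultimately show ?case by simp
qed

text \<open>If the partner \<open>g\<close> met \<open>r\<close>, the swapped trees would lie on
  levels \<open>k + 1\<close> and \<open>n - 1\<close> with the same total weight, against
  \<open>strictly_convex_below\<close>. Otherwise both levels stay, and minimality of
  \<open>G\<close> forces minimality of the new tree of level \<open>k\<close>.\<close>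

lemma min_trees_exchange:
  assumes strict: "strictly_convex_at k" and "n \<le> k"
    and F: "F \<in> min_trees k" and G: "G \<in> min_trees n"
    and e: "e \<in> F" "e \<notin> G" "r \<notin> e"
  obtains g where "g \<in> G" "g \<notin> F" "r \<notin> g" "insert g (F - {e}) \<in> min_trees k"
proof -
  note F' = min_treesD[OF F] and G' = min_treesD[OF G]
  obtain g where g: "g \<in> G" "g \<notin> F" "sptree (insert g (F - {e}))" "sptree (insert e (G - {g}))"
    using symmetric_exchange[OF F'(2) G'(2) e(1,2)] by blast
  note sum = exchange_sum[OF F'(2) G'(2) e(1,2) g(1,2)]
  note degF = exchange_rdeg[OF F'(2) e(1) g(2)] and degG = exchange_rdeg[OF G'(2) g(1) e(2)]
  have rg: "r \<notin> g"
  proof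
    assume "r \<in> g"
    \<comment> \<open>\<open>1 \<le> n\<close> holds because \<open>g\<close> is an edge of
      \<open>G\<close> at \<open>r\<close>.\<close>
    then have "insert g (F - {e}) \<in> trees (k + 1)" "insert e (G - {g}) \<in> trees (n - 1)" "1 \<le> n"
      using degF degG e(3) g(3,4) F'(4) G'(4) by (auto simp: trees_def)
    with strictly_convex_below[OF strict _ \<open>n \<le> k\<close> F _ _ G] sum show False
      by fastforce
  qed
  then have FF: "insert g (F - {e}) \<in> trees k" and GG: "insert e (G - {g}) \<in> trees n"
    using degF degG e(3) g(3,4) F'(4) G'(4) by (auto simp: trees_def)
  have "insert g (F - {e}) \<in> min_trees k"
    using min_treesI[OF FF F] min_trees_le[OF G GG] sum by simp
  with g(1,2) rg that show thesis by blast
qed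

text \<open>A minimal tree of level \<open>k\<close> closest to \<open>G\<close> works: any edge off
  \<open>r\<close> outside \<open>G\<close> could still be exchanged for one of
  \<open>G\<close>.\<close>

lemma min_tree_contains_min_tree:
  assumes strict: "strictly_convex_at k" and "n \<le> k" and "min_trees k \<noteq> {}"
    and G: "G \<in> min_trees n"
  obtains F where "F \<in> min_trees k" "nr F \<subseteq> G"
proof -
  obtain F0 where "F0 \<in> min_trees k" using assms(3) by blast
  from ex_has_least_nat[of "\<lambda>F. F \<in> min_trees k", OF this, of "\<lambda>F. card (F - G)"]
  obtain F where F: "F \<in> min_trees k" and least: "\<And>F'. F' \<in> min_trees k \<Longrightarrow> card (F - G) \<le> card (F' - G)"
    by blast
  have "nr F \<subseteq> G"
  proof
    fix e assume "e \<in> nr F"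
    then have e: "e \<in> F" "r \<notin> e" by auto
    show "e \<in> G"
    proof (rule ccontr)
      assume "e \<notin> G"
      with min_trees_exchange[OF strict \<open>n \<le> k\<close> F G e(1) _ e(2)] obtain g
        where "g \<in> G" "insert g (F - {e}) \<in> min_trees k" by blast
      with least[of "insert g (F - {e})"] swap_card_less[OF min_treesD(3)[OF F] e(1) \<open>e \<notin> G\<close>]
      show False by fastforce
    qed
  qed
  with F that show thesis by blast
qed

section \<open>Vertices sharing a component in all minimal trees without \<open>r\<close>\<close>

definition inseparable :: "nat \<Rightarrow> 'a rel" where
  "inseparable k = {(x, y). \<forall>F\<in>min_trees k. (x, y) \<in> linked (nr F)}"

lemma nr_props:
  assumes "F \<in> min_trees k"
  shows "circuit_free (nr F)" "doubletons (nr F)" "finite (nr F)"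
proof -
  note F = min_treesD[OF assms]
  show "circuit_free (nr F)"
    by (rule circuit_free_subset[OF sptree_circuit_free[OF F(2)]]) auto
  show "doubletons (nr F)"
    using sptree_doubletons[OF F(2)] by (auto simp: doubletons_def)
  show "finite (nr F)"
    using F(3) by simp
qed

text \<open>Exchanging an edge between \<open>x\<close> and \<open>y\<close> keeps the components, since the new edge has to
  reconnect \<open>x\<close> and \<open>y\<close>. So a forest with the components of \<open>F'\<close> that is closest to \<open>F\<close>
  links \<open>x\<close> and \<open>y\<close> by edges of \<open>F\<close>.\<close>

lemma inseparable_linked_Int:
  assumes strict: "strictly_convex_at k"
    and F: "F \<in> min_trees k" and F': "F' \<in> min_trees k" and xy: "(x, y) \<in> inseparable k"
  obtains H where "H \<in> min_trees k" "linked (nr H) = linked (nr F')" "(x, y) \<in> linked (nr H \<inter> F)"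
proof -
  let ?P = "\<lambda>H. H \<in> min_trees k \<and> linked (nr H) = linked (nr F')"
  from ex_has_least_nat[of ?P F' "\<lambda>H. card (H - F)"] F'
  obtain H where H: "H \<in> min_trees k" "linked (nr H) = linked (nr F')"
    and least: "\<And>H'. ?P H' \<Longrightarrow> card (H - F) \<le> card (H' - F)"
    by blast
  have "(x, y) \<in> linked (nr H \<inter> F)"
  proof (rule ccontr)
    assume *: "(x, y) \<notin> linked (nr H \<inter> F)"
    have xyH: "(x, y) \<in> linked (nr H)"
      using xy H(1) by (auto simp: inseparable_def)
    from separating_edge[OF nr_props[OF H(1)] xyH *] obtain g
      where g: "g \<in> nr H" "g \<notin> nr H \<inter> F" and sep: "(x, y) \<notin> linked (nr H - {g})"
      by blast
    then have g': "g \<in> H" "g \<notin> F" "r \<notin> g" by auto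
    from min_trees_exchange[OF strict _ H(1) F g'] obtain h
      where h: "h \<in> F" "h \<notin> H" "r \<notin> h" and H': "insert h (H - {g}) \<in> min_trees k"
      by blast
    let ?D = "nr H - {g}"
    have nrH': "nr (insert h (H - {g})) = insert h ?D"
      using h(3) by auto
    have xyH': "(x, y) \<in> linked (insert h ?D)"
      using xy H' unfolding nrH'[symmetric] by (auto simp: inseparable_def)
    obtain u v where uv: "g = {u, v}"
      using nr_props(2)[OF H(1)] g(1) unfolding doubletons_def by blast
    obtain a b where ab: "h = {a, b}"
      using nr_props(2)[OF F] h unfolding doubletons_def by blast
    have up: "(c, d) \<in> linked (insert h ?D)" if "(c, d) \<in> linked ?D" for c d
      by (rule linked_mono[OF _ that]) auto
    have up': "(c, d) \<in> linked (nr H)" if "(c, d) \<in> linked ?D" for c d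
      by (rule linked_mono[OF _ that]) auto
    have "(x, u) \<in> linked ?D \<and> (v, y) \<in> linked ?D \<or> (x, v) \<in> linked ?D \<and> (u, y) \<in> linked ?D"
      using linked_Diff_edge[OF xyH, of u v] sep unfolding uv by blast
    with up xyH' have uvD: "(u, v) \<in> linked (insert h ?D)"
      by (meson linked_sym linked_trans)
    have "(x, a) \<in> linked ?D \<and> (b, y) \<in> linked ?D \<or> (x, b) \<in> linked ?D \<and> (a, y) \<in> linked ?D"
      using linked_insert_cases[of x y a b ?D] xyH' sep unfolding ab by blast
    with up' xyH have abH: "(a, b) \<in> linked (nr H)"
      by (meson linked_sym linked_trans)
    \<comment> \<open>Without \<open>g\<close>, the vertices \<open>x\<close> and \<open>y\<close>
      fall into two parts, each holding one end of \<open>g\<close> and one end of \<open>h\<close>;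
      so either edge makes up for the other.\<close>
    have "linked (insert h ?D) = linked (nr H)"
    proof (rule equalityI; rule subrelI)
      fix c d assume "(c, d) \<in> linked (insert h ?D)"
      then show "(c, d) \<in> linked (nr H)"
      proof (rule linked_subI)
        fix s t assume "{s, t} \<in> insert h ?D"
        then consider "{s, t} = {a, b}" | "{s, t} \<in> nr H"
          by (auto simp: ab)
        then show "(s, t) \<in> linked (nr H)"
          using abH linked_sym[OF abH] by cases (auto simp: doubleton_eq_iff intro: linked_edge)
      qed
    next
      fix c d assume "(c, d) \<in> linked (nr H)"
      then show "(c, d) \<in> linked (insert h ?D)"
      proof (rule linked_subI)
        fix s t assume "{s, t} \<in> nr H"
        then consider "{s, t} = {u, v}" | "{s, t} \<in> insert h ?D"
          by (auto simp: uv)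
        then show "(s, t) \<in> linked (insert h ?D)"
          using uvD linked_sym[OF uvD] by cases (auto simp: doubleton_eq_iff intro: linked_edge)
      qed
    qed
    with H(2) H' nrH' have "?P (insert h (H - {g}))" by simp
    from least[OF this] swap_card_less[OF min_treesD(3)[OF H(1)] g'(1,2) h(1)] show False
      by simp
  qed
  with H that show thesis by blast
qed

text \<open>\<open>P\<close> is the path of \<open>F\<close> from \<open>x\<close> to
  \<open>y\<close>. For any minimal \<open>F'\<close>, the preceding lemma gives \<open>H\<close>
  with the components of \<open>F'\<close> that links \<open>x\<close> and \<open>y\<close> by edges
  of \<open>F\<close>; path uniqueness puts all of \<open>P\<close> into \<open>H\<close>. So every
  vertex on \<open>P\<close> shares the component of \<open>x\<close> in \<open>F'\<close>.\<close>

lemma inseparable_linked_within: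
  assumes strict: "strictly_convex_at k" and F: "F \<in> min_trees k" and xy: "(x, y) \<in> inseparable k"
  shows "(x, y) \<in> linked {e \<in> nr F. e \<subseteq> inseparable k `` {x}}"
proof -
  define P where "P = {g \<in> nr F. (x, y) \<notin> linked (nr F - {g})}"
  have xyF: "(x, y) \<in> linked (nr F)"
    using xy F by (auto simp: inseparable_def)
  \<comment> \<open>\<open>separating_edge\<close> with \<open>Q = P\<close> would yield an edge
    outside \<open>P\<close> that separates \<open>x\<close> from \<open>y\<close>, against the
    definition of \<open>P\<close>.\<close>
  have xyP: "(x, y) \<in> linked P"
  proof (rule ccontr)
    assume "(x, y) \<notin> linked P"
    from separating_edge[OF nr_props[OF F] xyF this] show False
      by (auto simp: P_def)
  qed
  have P_same: "(x, z) \<in> inseparable k" if xz: "(x, z) \<in> linked P" for z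
    unfolding inseparable_def
  proof (safe)
    fix F' assume F': "F' \<in> min_trees k"
    obtain H where H: "H \<in> min_trees k" "linked (nr H) = linked (nr F')" "(x, y) \<in> linked (nr H \<inter> F)"
      using inseparable_linked_Int[OF strict F F' xy] by blast
    have "P \<subseteq> nr H"
    proof
      fix g assume g: "g \<in> P"
      show "g \<in> nr H"
      proof (rule ccontr)
        assume "g \<notin> nr H"
        then have "nr H \<inter> F \<subseteq> nr F - {g}" by auto
        from linked_mono[OF this H(3)] g show False by (simp add: P_def)
      qed
    qed
    from linked_mono[OF this xz] H(2) show "(x, z) \<in> linked (nr F')" by simp
  qed
  show ?thesis
    using xyP
  proof (induction rule: linked_induct)
    case (step y z)
    have "(x, z) \<in> linked P"
      using step(1) linked_edge[OF step(2)] by (rule linked_trans)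
    with step(1) P_same have "{y, z} \<subseteq> inseparable k `` {x}" by auto
    with step(2) have "{y, z} \<in> {e \<in> nr F. e \<subseteq> inseparable k `` {x}}"
      by (auto simp: P_def)
    from step(3) linked_edge[OF this] show ?case by (rule linked_trans)
  qed simp
qed

lemma min_tree_links_inseparable:
  assumes strict: "strictly_convex_at k" and "n \<le> k" and "min_trees k \<noteq> {}"
    and G: "G \<in> min_trees n" and xy: "(x, y) \<in> inseparable k"
  shows "(x, y) \<in> linked {e \<in> nr G. e \<subseteq> inseparable k `` {x}}"
proof -
  obtain F where "F \<in> min_trees k" "nr F \<subseteq> G"
    using min_tree_contains_min_tree[OF assms(1-4)] by blast
  with inseparable_linked_within[OF strict _ xy, of F]
  show ?thesis by (auto elim!: linked_mono[rotated])
qed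

end

section \<open>Forests as relations\<close>

abbreviation digr :: "'a set \<Rightarrow> 'a rel \<Rightarrow> ('a, 'a \<times> 'a) pre_digraph" where
  "digr X R \<equiv> with_proj \<lparr> pverts = X, parcs = R \<rparr>"

text \<open>Outdegree at most one is single-valuedness, so \<open>X - Domain R\<close> is the set of
  roots and each non-root carries exactly one arc.\<close>

definition forest_rel :: "'a set \<Rightarrow> 'a rel \<Rightarrow> bool" where
  "forest_rel X R \<longleftrightarrow> finite X \<and> R \<subseteq> X \<times> X \<and> acyclic R \<and> single_valued R"

definition undirected :: "'a rel \<Rightarrow> 'a set set" where
  "undirected R = (\<lambda>(i, j). {i, j}) ` R"

lemma doubleton_in_undirected: "{a, b} \<in> undirected R \<longleftrightarrow> (a, b) \<in> R \<or> (b, a) \<in> R"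
  by (auto simp: undirected_def doubleton_eq_iff image_iff)

lemma undirected_mono: "R \<subseteq> S \<Longrightarrow> undirected R \<subseteq> undirected S"
  by (auto simp: undirected_def)

lemma forest_relD:
  assumes "forest_rel X R"
  shows "finite X" "R \<subseteq> X \<times> X" "finite R" "acyclic R" "single_valued R"
  using assms finite_subset[of R "X \<times> X"] by (auto simp: forest_rel_def)

lemma forest_rel_subset:
  assumes "forest_rel X R" "Y \<subseteq> X" "S \<subseteq> R" "S \<subseteq> Y \<times> Y"
  shows "forest_rel Y S"
  using assms finite_subset[OF assms(2)] acyclic_subset[OF _ assms(3)] single_valued_subset[OF assms(3)]
  by (simp add: forest_rel_def)

lemma acyclic_rank:
  fixes d :: "'a \<Rightarrow> nat"
  assumes "\<And>x y. (x, y) \<in> R \<Longrightarrow> d y < d x"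
  shows "acyclic R"
proof -
  have "R \<subseteq> (Wellfounded.measure d)\<inverse>"
    using assms by auto
  then show ?thesis
    by (meson acyclic_converse acyclic_subset wf_acyclic wf_measure)
qed

text \<open>The rank of \<open>x\<close> is the number of vertices reachable from it by at least one
  arc; it drops along arcs because no vertex reaches itself.\<close>

lemma forest_rel_rank:
  assumes "forest_rel X R"
  obtains d :: "'a \<Rightarrow> nat" where "\<And>x y. (x, y) \<in> R \<Longrightarrow> d y < d x"
proof
  fix x y assume xy: "(x, y) \<in> R"
  note R = forest_relD[OF assms]
  have "R\<^sup>+ `` {y} \<subset> R\<^sup>+ `` {x}"
  proof
    show "R\<^sup>+ `` {y} \<subseteq> R\<^sup>+ `` {x}"
      using xy by (auto intro: trancl_into_trancl2)
    have "y \<in> R\<^sup>+ `` {x}" "y \<notin> R\<^sup>+ `` {y}"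
      using xy R(4) by (auto simp: acyclic_def)
    then show "R\<^sup>+ `` {y} \<noteq> R\<^sup>+ `` {x}" by blast
  qed
  moreover have "finite (R\<^sup>+ `` {x})"
    using R(3) by (simp add: finite_Image)
  ultimately show "card (R\<^sup>+ `` {y}) < card (R\<^sup>+ `` {x})"
    by (simp add: psubset_card_mono)
qed

lemma single_valued_inj_fst: "single_valued R \<Longrightarrow> inj_on fst R"
  by (auto simp: inj_on_def single_valued_def)

lemma sum_Domain:
  assumes "single_valued R"
  shows "(\<Sum>(i, j)\<in>R. g i) = sum g (Domain R)"
proof -
  have "Domain R = fst ` R" by force
  then show ?thesis
    using sum.reindex[OF single_valued_inj_fst[OF assms], of g] by (simp add: case_prod_unfold)
qed

section \<open>Circuits, roots and components of digraphs given by relations\<close>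

lemma wf_digr: "wf_digraph (digr X R) \<longleftrightarrow> R \<subseteq> X \<times> X"
  by (auto simp: wf_digraph_def)

lemma linked_class_eq:
  assumes "(x, y) \<in> linked B"
  shows "linked B `` {x} = linked B `` {y}"
proof -
  have "(x, z) \<in> linked B \<longleftrightarrow> (y, z) \<in> linked B" for z
    using assms by (meson linked_sym linked_trans)
  then show ?thesis by auto
qed

text \<open>A nonempty closed walk contains a cycle, so freedom from cycles is acyclicity of
  \<open>R\<close>. If \<open>X\<close> is infinite or \<open>R\<close> leaves \<open>X\<close>,
  both sides are false.\<close>

lemma directed_forest_digr: "directed_forest (digr X R) \<longleftrightarrow> forest_rel X R"
proof (cases "finite X \<and> R \<subseteq> X \<times> X")
  case True
  then have fin: "finite R"
    using finite_subset by blast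
  interpret fin_digraph "digr X R"
    using True fin by unfold_locales auto
  have "(\<exists>c. cycle c) \<longleftrightarrow> \<not> acyclic R"
  proof
    assume "\<exists>c. cycle c"
    then obtain c u where "awalk u c u" "c \<noteq> []"
      by (auto simp: cycle_def)
    then have "(u, u) \<in> R\<^sup>+"
      using reachable1_awalkI[of u c u] by simp
    then show "\<not> acyclic R"
      by (auto simp: acyclic_def)
  next
    assume "\<not> acyclic R"
    then obtain u where "(u, u) \<in> R\<^sup>+"
      by (auto simp: acyclic_def)
    then obtain c where "awalk u c u" "c \<noteq> []"
      using reachable1_awalk[of u u] by auto
    then show "\<exists>c. cycle c"
      by (intro closed_w_imp_cycle[of c]) (auto simp: closed_w_def)
  qed
  moreover have "(\<forall>x\<in>X. out_degree (digr X R) x \<le> 1) \<longleftrightarrow> single_valued R"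
  proof -
    have "out_degree (digr X R) x \<le> 1 \<longleftrightarrow> (\<forall>y z. (x, y) \<in> R \<longrightarrow> (x, z) \<in> R \<longrightarrow> y = z)" for x
      using card_le_Suc0_iff_eq[of "{e \<in> R. fst e = x}"] fin
      by (auto simp: out_degree_def out_arcs_def)
    with True show ?thesis
      by (auto simp: single_valued_def)
  qed
  ultimately show ?thesis
    using True fin_digraph_axioms by (auto simp: directed_forest_def forest_rel_def)
next
  case False
  then show ?thesis
    by (auto simp: directed_forest_def forest_rel_def fin_digraph_def fin_digraph_axioms_def wf_digr)
qed

lemma roots_digr: "finite R \<Longrightarrow> roots (digr X R) = X - Domain R"
  by (auto simp: roots_def out_degree_def out_arcs_def)

lemma arc_weight_digr: "arc_weight v (digr X R) = sum v R"
  by (simp add: arc_weight_def)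

lemma linked_undirected_closed:
  assumes "(x, y) \<in> linked (undirected R)" "R \<subseteq> X \<times> X" "x \<in> X"
  shows "y \<in> X"
  using assms(1,3) by (rule linked_closed) (use assms(2) in \<open>auto simp: doubleton_in_undirected\<close>)

text \<open>In the symmetric closure reachability is symmetric, so the strongly connected component
  of \<open>x\<close> is all that is reachable from it.\<close>

lemma wcc_verts_digr:
  assumes "R \<subseteq> X \<times> X"
  shows "wcc_verts (digr X R) = (\<lambda>x. linked (undirected R) `` {x}) ` X"
proof -
  let ?S = "mk_symmetric (digr X R)"
  have pv: "pverts ?S = X" and ps: "parcs ?S = {(a, b). {a, b} \<in> undirected R}"
    by (auto simp: mk_symmetric_def doubleton_in_undirected)
  interpret wf_digraph "with_proj ?S"
    using assms by unfold_locales (auto simp: pv ps doubleton_in_undirected)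
  have reach: "x \<rightarrow>\<^sup>*\<^bsub>with_proj ?S\<^esub> y \<longleftrightarrow> (x, y) \<in> linked (undirected R)" if "x \<in> X" for x y
  proof
    assume "x \<rightarrow>\<^sup>*\<^bsub>with_proj ?S\<^esub> y"
    from reachable_rtranclI[OF this] show "(x, y) \<in> linked (undirected R)"
      by (simp add: linked_def ps)
  next
    assume "(x, y) \<in> linked (undirected R)"
    then show "x \<rightarrow>\<^sup>*\<^bsub>with_proj ?S\<^esub> y"
    proof (induction rule: linked_induct)
      case refl
      show ?case using that by (simp add: pv)
    next
      case (step y z)
      then show ?case
        using reachable_adj_trans[of x y z] by (simp add: ps)
    qed
  qed
  have "scc_of x = linked (undirected R) `` {x}" if "x \<in> X" for x
  proof -
    have "x \<rightarrow>\<^sup>*\<^bsub>with_proj ?S\<^esub> y \<and> y \<rightarrow>\<^sup>*\<^bsub>with_proj ?S\<^esub> x \<longleftrightarrow> (x, y) \<in> linked (undirected R)" for y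
      using reach[OF that, of y] reach[of y x] linked_undirected_closed[OF _ assms that, of y]
        linked_sym[of x y] by blast
    then show ?thesis by (auto simp: scc_of_def)
  qed
  then show ?thesis
    unfolding wcc_verts_def sccs_verts_conv_scc_of by (simp add: pv)
qed

text \<open>Following the arcs from \<open>x\<close> must stop, as the converse of a finite acyclic
  relation is well-founded.\<close>

lemma forest_rel_root:
  assumes "forest_rel X R" "x \<in> X"
  obtains s where "s \<in> X - Domain R" "(x, s) \<in> R\<^sup>*"
proof -
  note R = forest_relD[OF assms(1)]
  have "wf (R\<inverse>)"
    using finite_acyclic_wf_converse R(3,4) by blast
  then have "x \<in> X \<longrightarrow> (\<exists>s. s \<in> X - Domain R \<and> (x, s) \<in> R\<^sup>*)"
  proof (induction x rule: wf_induct_rule)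
    case (less x)
    show ?case
    proof (cases "x \<in> Domain R")
      case True
      then obtain y where y: "(x, y) \<in> R" by blast
      with R(2) less[of y] show ?thesis
        by (auto intro: converse_rtrancl_into_rtrancl)
    qed auto
  qed
  with assms(2) that show thesis by blast
qed

text \<open>Each vertex has a single forward path, and linked vertices run into a common one: an arc
  traversed forwards either extends the path or is its first arc.\<close>

lemma linked_undirected_meet:
  assumes "(x, y) \<in> linked (undirected R)" "single_valued R"
  shows "\<exists>z. (x, z) \<in> R\<^sup>* \<and> (y, z) \<in> R\<^sup>*"
  using assms(1)
proof (induction rule: linked_induct)
  case (step y y')
  then obtain z where z: "(x, z) \<in> R\<^sup>*" "(y, z) \<in> R\<^sup>*" by blast
  from step(2) consider "(y', y) \<in> R" | "(y, y') \<in> R"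
    by (auto simp: doubleton_in_undirected)
  then show ?case
  proof cases
    case 1
    with z show ?thesis by (blast intro: converse_rtrancl_into_rtrancl)
  next
    case yy': 2
    from z(2) show ?thesis
    proof (cases rule: converse_rtranclE)
      case base
      with z yy' show ?thesis by (blast intro: rtrancl_into_rtrancl)
    next
      case (step w)
      with yy' assms(2) have "w = y'" by (auto simp: single_valued_def)
      with step z show ?thesis by blast
    qed
  qed
qed auto

lemma rtrancl_imp_linked: "(x, y) \<in> R\<^sup>* \<Longrightarrow> (x, y) \<in> linked (undirected R)"
  unfolding linked_def by (erule rtrancl_mono[THEN subsetD, rotated]) (auto simp: doubleton_in_undirected)

lemma linked_roots_eq:
  assumes "(s, t) \<in> linked (undirected R)" "single_valued R" "s \<notin> Domain R" "t \<notin> Domain R"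
  shows "s = t"
proof -
  obtain z where z: "(s, z) \<in> R\<^sup>*" "(t, z) \<in> R\<^sup>*"
    using linked_undirected_meet[OF assms(1,2)] by blast
  from z(1) assms(3) have "s = z" by (auto elim: converse_rtranclE)
  moreover from z(2) assms(4) have "t = z" by (auto elim: converse_rtranclE)
  ultimately show ?thesis by simp
qed

text \<open>Each component contains exactly one root, so trees are counted by
  \<open>X - Domain R\<close> from here on.\<close>

lemma card_wcc_verts_digr:
  assumes "forest_rel X R"
  shows "card (wcc_verts (digr X R)) = card (X - Domain R)"
proof -
  let ?f = "\<lambda>x. linked (undirected R) `` {x}"
  note R = forest_relD[OF assms]
  have inj: "inj_on ?f (X - Domain R)"
  proof (rule inj_onI)
    fix s t assume *: "s \<in> X - Domain R" "t \<in> X - Domain R" "?f s = ?f t"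
    then have "(s, t) \<in> linked (undirected R)"
      by (metis ImageE ImageI linked_refl singletonI singletonD)
    with * R(5) show "s = t" by (auto intro: linked_roots_eq)
  qed
  have "?f ` (X - Domain R) = ?f ` X"
  proof
    show "?f ` X \<subseteq> ?f ` (X - Domain R)"
    proof
      fix C assume "C \<in> ?f ` X"
      then obtain x where x: "x \<in> X" "C = ?f x" by blast
      obtain s where s: "s \<in> X - Domain R" "(x, s) \<in> R\<^sup>*"
        using forest_rel_root[OF assms x(1)] by blast
      have "?f s = ?f x"
        using linked_class_eq[OF rtrancl_imp_linked[OF s(2)]] by simp
      with s(1) x(2) show "C \<in> ?f ` (X - Domain R)" by auto
    qed
  qed auto
  with card_image[OF inj] show ?thesis
    by (simp add: wcc_verts_digr[OF R(2)])
qed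

text \<open>Compatibility fixes the tail and head maps, so a spanning subgraph is determined by its
  arc set.\<close>

lemma spanning_with_proj:
  assumes "pair_wf_digraph G"
  shows "spanning F (with_proj G) \<longleftrightarrow> (\<exists>R \<subseteq> parcs G. R \<subseteq> pverts G \<times> pverts G \<and> F = digr (pverts G) R)"
proof
  assume F: "spanning F (with_proj G)"
  then have "F = digr (pverts G) (arcs F)"
    by (auto simp: spanning_def subgraph_def compatible_def with_proj_def)
  moreover from F this have "arcs F \<subseteq> parcs G" "arcs F \<subseteq> pverts G \<times> pverts G"
    using wf_digr[of "pverts G" "arcs F"] by (auto simp: spanning_def subgraph_def)
  ultimately show "\<exists>R \<subseteq> parcs G. R \<subseteq> pverts G \<times> pverts G \<and> F = digr (pverts G) R" by blast
next
  interpret pair_wf_digraph G by fact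
  assume "\<exists>R \<subseteq> parcs G. R \<subseteq> pverts G \<times> pverts G \<and> F = digr (pverts G) R"
  then show "spanning F (with_proj G)"
    using wf_digraph_axioms
    by (auto simp: spanning_def subgraph_def compatible_def wf_digr)
qed

section \<open>Forests and minimal forests with \<open>n\<close> trees as relations\<close>

definition spanning_rels :: "'a pair_pre_digraph \<Rightarrow> nat \<Rightarrow> 'a rel set" where
  "spanning_rels G n =
     {R. R \<subseteq> parcs G \<and> forest_rel (pverts G) R \<and> card (pverts G - Domain R) = n}"

lemma spanning_forests_eq:
  assumes "pair_wf_digraph G"
  shows "spanning_forests (with_proj G) n = digr (pverts G) ` spanning_rels G n"
proof (intro equalityI subsetI)
  fix F assume "F \<in> spanning_forests (with_proj G) n"
  then obtain R where R: "R \<subseteq> parcs G" "F = digr (pverts G) R"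
    and F: "directed_forest F" "card (wcc_verts F) = n"
    by (auto simp: spanning_forests_def spanning_with_proj[OF assms])
  from F(1) have "forest_rel (pverts G) R"
    by (simp add: R(2) directed_forest_digr)
  with F(2) R(1) have "R \<in> spanning_rels G n"
    by (simp add: R(2) spanning_rels_def card_wcc_verts_digr)
  then show "F \<in> digr (pverts G) ` spanning_rels G n"
    unfolding R(2) by (rule imageI)
next
  fix F assume "F \<in> digr (pverts G) ` spanning_rels G n"
  then obtain R where R: "R \<in> spanning_rels G n" and F: "F = digr (pverts G) R"
    by (rule imageE)
  then have "forest_rel (pverts G) R" "R \<subseteq> parcs G" "card (pverts G - Domain R) = n"
    by (simp_all add: spanning_rels_def)
  then show "F \<in> spanning_forests (with_proj G) n"
    unfolding F spanning_forests_def spanning_with_proj[OF assms]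
    using forest_relD(2) by (simp add: directed_forest_digr card_wcc_verts_digr) blast
qed

lemma spanning_trees_eq:
  assumes "pair_wf_digraph G"
  shows "spanning_trees (with_proj G) = digr (pverts G) ` spanning_rels G 1"
  unfolding spanning_forests_eq[OF assms, symmetric]
  by (auto simp: spanning_trees_def spanning_forests_def directed_tree_def)

lemma directed_tree_digr:
  "directed_tree (digr X R) \<longleftrightarrow> forest_rel X R \<and> card (X - Domain R) = 1"
  by (auto simp: directed_tree_def directed_forest_digr card_wcc_verts_digr)

lemma induce_digr: "with_proj G \<restriction> X = digr X (parcs G \<inter> X \<times> X)"
  by (auto simp: induce_subgraph_def with_proj_def)

lemma finite_spanning_rels:
  assumes "finite (parcs G)"
  shows "finite (spanning_rels G n)"
  by (rule finite_subset[of _ "Pow (parcs G)"]) (use assms in \<open>auto simp: spanning_rels_def\<close>)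

definition min_rels :: "'a pair_pre_digraph \<Rightarrow> ('a \<times> 'a) weight_fun \<Rightarrow> nat \<Rightarrow> 'a rel set" where
  "min_rels G v n = {R \<in> spanning_rels G n. \<forall>S\<in>spanning_rels G n. sum v R \<le> sum v S}"

lemma phi_eq:
  assumes "pair_wf_digraph G"
  shows "phi (with_proj G) v n = (INF R\<in>spanning_rels G n. ereal (sum v R))"
  unfolding phi_def spanning_forests_eq[OF assms] image_image arc_weight_digr ..

lemma min_forests_eq:
  assumes "pair_wf_digraph G"
  shows "min_forests (with_proj G) v n = digr (pverts G) ` min_rels G v n"
proof -
  have "ereal (sum v R) = phi (with_proj G) v n \<longleftrightarrow> (\<forall>S\<in>spanning_rels G n. sum v R \<le> sum v S)"
    if "R \<in> spanning_rels G n" for R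
  proof
    assume "ereal (sum v R) = phi (with_proj G) v n"
    then have "ereal (sum v R) \<le> ereal (sum v S)" if "S \<in> spanning_rels G n" for S
      using that by (auto simp: phi_eq[OF assms] intro: INF_lower)
    then show "\<forall>S\<in>spanning_rels G n. sum v R \<le> sum v S" by simp
  next
    assume "\<forall>S\<in>spanning_rels G n. sum v R \<le> sum v S"
    then show "ereal (sum v R) = phi (with_proj G) v n"
      unfolding phi_eq[OF assms] using that
      by (intro antisym INF_greatest INF_lower) auto
  qed
  then show ?thesis
    unfolding min_forests_def spanning_forests_eq[OF assms] min_rels_def
    by (auto simp: arc_weight_digr)
qed

lemma min_rels_nonempty:
  assumes "finite (parcs G)" "spanning_rels G n \<noteq> {}"
  shows "min_rels G v n \<noteq> {}"
  using arg_min_if_finite[OF finite_spanning_rels[OF assms(1)] assms(2), of "sum v"]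
  by (auto simp: min_rels_def not_less intro!: exI[of _ "arg_min_on (sum v) (spanning_rels G n)"])

lemma phi_min_rels:
  assumes "pair_wf_digraph G" "R \<in> min_rels G v n"
  shows "phi (with_proj G) v n = ereal (sum v R)"
proof -
  have "digr (pverts G) R \<in> min_forests (with_proj G) v n"
    using assms by (auto simp: min_forests_eq)
  then show ?thesis
    by (simp add: min_forests_def arc_weight_digr)
qed

section \<open>Elementary sets\<close>

text \<open>\<open>Pow X\<close> is one of the intersected algebras, so the intersection stays
  within \<open>X\<close>.\<close>

lemma algebra_hull:
  assumes "C \<subseteq> Pow X"
  shows "algebra X (algebra X hull C)"
proof -
  have *: "algebra X (Pow X)"
    by (simp add: algebra_iff_Un)
  show ?thesis
    unfolding hull_def
  proof (subst algebra_iff_Un, intro conjI)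
    show "\<Inter> {t. algebra X t \<and> C \<subseteq> t} \<subseteq> Pow X"
      using * assms by (intro Inter_lower) simp
  qed (auto simp: algebra_iff_Un)
qed

text \<open>A class is a finite intersection of generators and complements, hence a member. The
  unions of classes form an algebra containing the generators, so every member is a union of classes
  and the minimal ones are single classes.\<close>

lemma elementary_sets_hull:
  assumes "finite X" "C \<subseteq> Pow X"
  shows "elementary_sets (algebra X hull C) = (\<lambda>x. {y \<in> X. \<forall>A\<in>C. x \<in> A \<longleftrightarrow> y \<in> A}) ` X"
proof -
  let ?M = "algebra X hull C" and ?cl = "\<lambda>x. {y \<in> X. \<forall>A\<in>C. x \<in> A \<longleftrightarrow> y \<in> A}"
  interpret algebra X ?M
    by (rule algebra_hull[OF assms(2)])
  have "finite C"
    using assms finite_subset by blast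
  have cl_in: "?cl x \<in> ?M" for x
  proof -
    \<comment> \<open>Induction over the finitely many generators, intersecting with
      \<open>A\<close> or its complement according to the side of \<open>x\<close>.\<close>
    have "finite D \<Longrightarrow> D \<subseteq> C \<Longrightarrow> {y \<in> X. \<forall>A\<in>D. x \<in> A \<longleftrightarrow> y \<in> A} \<in> ?M" for D
    proof (induction D rule: finite_induct)
      case (insert A D)
      have "A \<in> ?M"
        using insert.prems hull_subset[of C "algebra X"] by blast
      then have "(if x \<in> A then A else X - A) \<in> ?M"
        using compl_sets by auto
      moreover have "{y \<in> X. \<forall>A\<in>D. x \<in> A \<longleftrightarrow> y \<in> A} \<in> ?M"
        using insert by simp
      ultimately have "{y \<in> X. \<forall>A\<in>D. x \<in> A \<longleftrightarrow> y \<in> A} \<inter> (if x \<in> A then A else X - A) \<in> ?M"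
        by (rule Int[rotated])
      moreover have "{y \<in> X. \<forall>A\<in>D. x \<in> A \<longleftrightarrow> y \<in> A} \<inter> (if x \<in> A then A else X - A)
        = {y \<in> X. \<forall>A\<in>insert A D. x \<in> A \<longleftrightarrow> y \<in> A}"
        by auto
      ultimately show ?case by metis
    qed simp
    from this[OF \<open>finite C\<close>] show ?thesis by simp
  qed
  have "algebra X {B \<in> Pow X. \<forall>x\<in>B. ?cl x \<subseteq> B}"
    unfolding algebra_iff_Un
  proof (intro conjI ballI)
    fix B assume B: "B \<in> {B \<in> Pow X. \<forall>x\<in>B. ?cl x \<subseteq> B}"
    have "y \<notin> B" if "x \<in> X - B" "y \<in> ?cl x" for x y
    proof
      assume "y \<in> B"
      with B have "?cl y \<subseteq> B" by simp
      moreover have "x \<in> ?cl y" using that by simp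
      ultimately show False using that by blast
    qed
    then show "X - B \<in> {B \<in> Pow X. \<forall>x\<in>B. ?cl x \<subseteq> B}" by auto
  next
    fix A B
    assume "A \<in> {B \<in> Pow X. \<forall>x\<in>B. ?cl x \<subseteq> B}" "B \<in> {B \<in> Pow X. \<forall>x\<in>B. ?cl x \<subseteq> B}"
    then show "A \<union> B \<in> {B \<in> Pow X. \<forall>x\<in>B. ?cl x \<subseteq> B}" by (simp add: ball_Un le_supI1 le_supI2)
  qed auto
  moreover have "C \<subseteq> {B \<in> Pow X. \<forall>x\<in>B. ?cl x \<subseteq> B}"
    using assms(2) by auto
  ultimately have "?M \<subseteq> {B \<in> Pow X. \<forall>x\<in>B. ?cl x \<subseteq> B}"
    by (intro hull_minimal)
  then have sat: "B \<subseteq> X" "x \<in> B \<Longrightarrow> ?cl x \<subseteq> B" if "B \<in> ?M" for B x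
    using that by auto
  show ?thesis
  proof (intro equalityI subsetI)
    fix E assume "E \<in> elementary_sets ?M"
    then have E: "E \<in> ?M" "E \<noteq> {}" "\<And>B. B \<in> ?M \<Longrightarrow> B \<noteq> {} \<Longrightarrow> B \<subseteq> E \<Longrightarrow> B = E"
      by (auto simp: elementary_sets_def)
    then obtain x where x: "x \<in> E" "x \<in> X"
      using sat(1) by blast
    then have "?cl x \<noteq> {}" by auto
    with E(3)[OF cl_in[of x] _ sat(2)[OF E(1) x(1)]] x(2) show "E \<in> ?cl ` X"
      by blast
  next
    fix E assume "E \<in> ?cl ` X"
    then obtain x where x: "x \<in> X" "E = ?cl x" by blast
    have "B = E" if B: "B \<in> ?M" "B \<noteq> {}" "B \<subseteq> E" for B
    proof -
      obtain y where y: "y \<in> B" using B(2) by blast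
      with B(3) x have "?cl y = ?cl x" by auto
      with sat(2)[OF B(1) y] B(3) x(2) show ?thesis by simp
    qed
    moreover have "E \<noteq> {}" using x by auto
    ultimately show "E \<in> elementary_sets ?M"
      using cl_in x(2) by (auto simp: elementary_sets_def)
  qed
qed

text \<open>The elementary set of a vertex \<open>x\<close>. Without minimal forests of level
  \<open>k\<close> it is all of \<open>pverts G\<close>, in line with an algebra that has no
  generators.\<close>

definition cohesion_class ::
    "'a pair_pre_digraph \<Rightarrow> ('a \<times> 'a) weight_fun \<Rightarrow> nat \<Rightarrow> 'a \<Rightarrow> 'a set" where
  "cohesion_class G v k x = {y \<in> pverts G. \<forall>R\<in>min_rels G v k. (x, y) \<in> linked (undirected R)}"

lemma min_relsD:
  assumes "R \<in> min_rels G v n"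
  shows "R \<in> spanning_rels G n" "forest_rel (pverts G) R" "R \<subseteq> parcs G"
    "card (pverts G - Domain R) = n"
  using assms by (auto simp: min_rels_def spanning_rels_def)

text \<open>The generator to test with is the component of \<open>x\<close> in a given minimal
  forest: a \<open>y\<close> that no generator distinguishes from \<open>x\<close> must lie in
  it.\<close>

lemma elementary_sets_aleph:
  assumes "pair_fin_digraph G"
  shows "elementary_sets (aleph (with_proj G) v k) = cohesion_class G v k ` pverts G"
proof -
  interpret pair_fin_digraph G by fact
  have wf: "pair_wf_digraph G" by unfold_locales
  let ?C = "\<Union>R\<in>min_rels G v k. (\<lambda>x. linked (undirected R) `` {x}) ` pverts G"
  have sub: "R \<subseteq> pverts G \<times> pverts G" if "R \<in> min_rels G v k" for R
    using forest_relD(2)[OF min_relsD(2)[OF that]] .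
  have "?C \<subseteq> Pow (pverts G)"
    using sub linked_undirected_closed by fastforce
  have "aleph (with_proj G) v k = algebra (pverts G) hull ?C"
    using wcc_verts_digr[OF sub] by (simp add: aleph_def min_forests_eq[OF wf])
  then have "elementary_sets (aleph (with_proj G) v k)
      = (\<lambda>x. {y \<in> pverts G. \<forall>A\<in>?C. x \<in> A \<longleftrightarrow> y \<in> A}) ` pverts G"
    using elementary_sets_hull[OF pair_finite_verts \<open>?C \<subseteq> Pow (pverts G)\<close>] by simp
  also have "\<dots> = cohesion_class G v k ` pverts G"
  proof (rule image_cong[OF refl])
    fix x assume x: "x \<in> pverts G"
    have "(\<forall>A\<in>?C. x \<in> A \<longleftrightarrow> y \<in> A) \<longleftrightarrow> (\<forall>R\<in>min_rels G v k. (x, y) \<in> linked (undirected R))" for y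
    proof
      assume *: "\<forall>A\<in>?C. x \<in> A \<longleftrightarrow> y \<in> A"
      show "\<forall>R\<in>min_rels G v k. (x, y) \<in> linked (undirected R)"
      proof
        fix R assume "R \<in> min_rels G v k"
        with x have "linked (undirected R) `` {x} \<in> ?C" by auto
        from bspec[OF * this] show "(x, y) \<in> linked (undirected R)" by simp
      qed
    next
      assume *: "\<forall>R\<in>min_rels G v k. (x, y) \<in> linked (undirected R)"
      have "(z, x) \<in> linked (undirected R) \<longleftrightarrow> (z, y) \<in> linked (undirected R)"
        if "R \<in> min_rels G v k" for R z
        using * that by (meson linked_sym linked_trans)
      then show "\<forall>A\<in>?C. x \<in> A \<longleftrightarrow> y \<in> A" by auto
    qed
    then show "{y \<in> pverts G. \<forall>A\<in>?C. x \<in> A \<longleftrightarrow> y \<in> A} = cohesion_class G v k x"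
      by (simp add: cohesion_class_def)
  qed
  finally show ?thesis .
qed

lemma cohesion_class_self: "x \<in> pverts G \<Longrightarrow> x \<in> cohesion_class G v k x"
  by (simp add: cohesion_class_def)

lemma cohesion_class_eq:
  assumes "x \<in> cohesion_class G v k y"
  shows "cohesion_class G v k x = cohesion_class G v k y"
proof -
  have "(x, z) \<in> linked (undirected R) \<longleftrightarrow> (y, z) \<in> linked (undirected R)"
    if "R \<in> min_rels G v k" for R z
  proof -
    have "(y, x) \<in> linked (undirected R)"
      using assms that by (simp add: cohesion_class_def)
    then show ?thesis by (meson linked_sym linked_trans)
  qed
  then show ?thesis
    by (simp add: cohesion_class_def)
qed

section \<open>Potential weights\<close>

text \<open>Opposite arcs would form a circuit, so forgetting orientations loses no arc and sums
  over arcs become sums over edges.\<close>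

lemma forest_rel_inj_undirected:
  assumes "forest_rel X R"
  shows "inj_on (\<lambda>(i, j). {i, j}) R"
proof (rule inj_onI)
  fix a b assume ab: "a \<in> R" "b \<in> R" "(\<lambda>(i, j). {i, j}) a = (\<lambda>(i, j). {i, j}) b"
  obtain i j where a: "a = (i, j)" by (cases a)
  have "(j, i) \<notin> R"
  proof
    assume "(j, i) \<in> R"
    with ab(1) have "(i, i) \<in> R\<^sup>+"
      unfolding a by (meson trancl.r_into_trancl trancl_into_trancl)
    with forest_relD(4)[OF assms] show False by (auto simp: acyclic_def)
  qed
  with ab a show "a = b" by (cases b) (auto simp: doubleton_eq_iff)
qed

text \<open>\<open>w {i, j}\<close> stands for \<open>p i j\<close> and \<open>w {r, i}\<close> for \<open>p i i\<close>.\<close>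

locale potential_digraph = pair_digraph V
  for V :: "'a pair_pre_digraph" and v :: "('a \<times> 'a) weight_fun" and r :: 'a
    and w :: "'a set \<Rightarrow> real" +
  assumes r_notin: "r \<notin> pverts V"
    and arcs_sym: "(i, j) \<in> parcs V \<Longrightarrow> (j, i) \<in> parcs V"
    and weight: "(i, j) \<in> parcs V \<Longrightarrow> v (i, j) = w {i, j} - w {r, i}"
begin

definition spokes :: "'a set \<Rightarrow> 'a set set" where
  "spokes A = (\<lambda>x. {r, x}) ` A"

definition cone :: "'a rel \<Rightarrow> 'a set set" where
  "cone R = undirected R \<union> spokes (pverts V - Domain R)"

sublocale rooted_edge_weights "insert r (pverts V)" r "undirected (parcs V) \<union> spokes (pverts V)" w
proof
  show "finite (insert r (pverts V))"
    using pair_finite_verts by simp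
  fix e assume "e \<in> undirected (parcs V) \<union> spokes (pverts V)"
  then show "\<exists>u\<in>insert r (pverts V). \<exists>v\<in>insert r (pverts V). u \<noteq> v \<and> e = {u, v}"
  proof
    assume "e \<in> undirected (parcs V)"
    then obtain i j where "(i, j) \<in> parcs V" "e = {i, j}"
      by (auto simp: undirected_def)
    then have "i \<in> pverts V" "j \<in> pverts V" "i \<noteq> j"
      using wellformed' pair_no_loops[of "(i, j)"] by auto
    with \<open>e = {i, j}\<close> show ?thesis by blast
  next
    assume "e \<in> spokes (pverts V)"
    then show ?thesis
      using r_notin by (auto simp: spokes_def)
  qed
qed simp

lemma r_notin_undirected:
  assumes "R \<subseteq> pverts V \<times> pverts V" "e \<in> undirected R"
  shows "r \<notin> e"
  using assms r_notin by (auto simp: undirected_def)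

lemma cone_parts:
  assumes "R \<subseteq> pverts V \<times> pverts V"
  shows "{e \<in> cone R. r \<notin> e} = undirected R"
    and "{e \<in> cone R. r \<in> e} = spokes (pverts V - Domain R)"
  using r_notin_undirected[OF assms] by (auto simp: cone_def spokes_def)

lemma inj_spokes: "inj_on (\<lambda>x. {r, x}) (pverts V)"
  using r_notin by (auto simp: inj_on_def doubleton_eq_iff)

lemma sum_spokes:
  fixes g :: "'a set \<Rightarrow> 'b::comm_monoid_add"
  assumes "A \<subseteq> pverts V"
  shows "sum g (spokes A) = (\<Sum>x\<in>A. g {r, x})"
  unfolding spokes_def
  by (subst sum.reindex[OF inj_on_subset[OF inj_spokes assms]]) simp

text \<open>General in \<open>g\<close>: the constant 1 counts edges, and \<open>w\<close> gives
  weights.\<close>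

lemma sum_cone:
  fixes g :: "'a set \<Rightarrow> 'b::comm_monoid_add"
  assumes "forest_rel (pverts V) R"
  shows "sum g (cone R) = (\<Sum>(i, j)\<in>R. g {i, j}) + (\<Sum>x\<in>pverts V - Domain R. g {r, x})"
proof -
  note R = forest_relD[OF assms]
  have "sum g (cone R) = sum g (undirected R) + sum g (spokes (pverts V - Domain R))"
    unfolding cone_def
  proof (rule sum.union_disjoint)
    show "finite (undirected R)" using R(3) by (simp add: undirected_def)
    show "finite (spokes (pverts V - Domain R))" using R(1) by (simp add: spokes_def)
    show "undirected R \<inter> spokes (pverts V - Domain R) = {}"
      using r_notin_undirected[OF R(2)] by (auto simp: spokes_def)
  qed
  also have "sum g (undirected R) = (\<Sum>(i, j)\<in>R. g {i, j})"
    unfolding undirected_def sum.reindex[OF forest_rel_inj_undirected[OF assms]]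
    by (simp add: case_prod_unfold)
  finally show ?thesis by (simp add: sum_spokes)
qed

text \<open>One arc per non-root and one spoke per root give one edge per vertex of
  \<open>V\<close>; every vertex reaches a root, which is joined to \<open>r\<close>.\<close>

lemma cone_in_trees:
  assumes "R \<in> spanning_rels V n"
  shows "cone R \<in> trees n"
proof -
  have R: "forest_rel (pverts V) R" "R \<subseteq> parcs V" "card (pverts V - Domain R) = n"
    using assms by (auto simp: spanning_rels_def)
  note R' = forest_relD[OF R(1)]
  have dom: "Domain R \<subseteq> pverts V" using R'(2) by auto
  have "card (cone R) = (\<Sum>e\<in>cone R. 1)" by simp
  also have "\<dots> = (\<Sum>(i, j)\<in>R. 1) + card (pverts V - Domain R)"
    unfolding sum_cone[OF R(1)] by simp
  also have "(\<Sum>(i, j)\<in>R. 1) = card (Domain R)"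
    using sum_Domain[OF R'(5), of "\<lambda>_. 1::nat"] by simp
  also have "card (Domain R) + card (pverts V - Domain R) = card (pverts V)"
    using card_Un_disjoint[of "Domain R" "pverts V - Domain R"] R'(1,3) dom
    by (simp add: Un_absorb1 finite_Domain)
  finally have card: "card (cone R) = card (insert r (pverts V) - {r})"
    using r_notin by simp
  have "(r, x) \<in> linked (cone R)" if x: "x \<in> pverts V" for x
  proof -
    obtain s where s: "s \<in> pverts V - Domain R" "(x, s) \<in> R\<^sup>*"
      using forest_rel_root[OF R(1) x] by blast
    have "(r, s) \<in> linked (cone R)"
      using s(1) by (intro linked_edge) (simp add: cone_def spokes_def)
    moreover have "(s, x) \<in> linked (cone R)"
      using linked_mono[OF _ linked_sym[OF rtrancl_imp_linked[OF s(2)]], of "cone R"]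
      by (simp add: cone_def)
    ultimately show ?thesis by (rule linked_trans)
  qed
  moreover have "cone R \<subseteq> undirected (parcs V) \<union> spokes (pverts V)"
    using undirected_mono[OF R(2)] by (auto simp: cone_def spokes_def)
  moreover have "card {e \<in> cone R. r \<in> e} = n"
    unfolding cone_parts[OF R'(2)] spokes_def
    using R(3) card_image[OF inj_on_subset[OF inj_spokes, of "pverts V - Domain R"]] by simp
  ultimately show ?thesis
    using card by (auto simp: trees_def sptree_def)
qed

text \<open>The arc leaving a non-root \<open>i\<close> contributes \<open>- w {r, i}\<close> to the
  forest, and the spokes add \<open>w {r, x}\<close> for the roots, so the difference is a sum over
  all vertices, whatever the forest. This is where the potential form of the weights enters.\<close>

lemma sum_cone_weight:
  assumes "R \<in> spanning_rels V n"
  shows "sum w (cone R) = sum v R + (\<Sum>x\<in>pverts V. w {r, x})"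
proof -
  have R: "forest_rel (pverts V) R" "R \<subseteq> parcs V"
    using assms by (auto simp: spanning_rels_def)
  note R' = forest_relD[OF R(1)]
  have "sum v R = (\<Sum>(i, j)\<in>R. w {i, j} - w {r, i})"
    using R(2) weight by (intro sum.cong) auto
  also have "\<dots> = (\<Sum>(i, j)\<in>R. w {i, j}) - (\<Sum>(i, j)\<in>R. w {r, i})"
    by (simp add: case_prod_unfold sum_subtractf)
  also have "(\<Sum>(i, j)\<in>R. w {r, i}) = (\<Sum>x\<in>Domain R. w {r, x})"
    by (rule sum_Domain[OF R'(5)])
  finally have "sum v R = (\<Sum>(i, j)\<in>R. w {i, j}) - (\<Sum>x\<in>Domain R. w {r, x})" .
  moreover have "(\<Sum>x\<in>pverts V. w {r, x}) =
      (\<Sum>x\<in>pverts V - Domain R. w {r, x}) + (\<Sum>x\<in>Domain R. w {r, x})"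
    using R'(1,2) by (intro sum.subset_diff) auto
  ultimately show ?thesis
    by (simp add: sum_cone[OF R(1)])
qed

text \<open>Orient \<open>B\<close> towards \<open>r\<close> and drop the arcs into
  \<open>r\<close>, whose tails become the roots.\<close>

lemma trees_imp_cone:
  assumes "B \<in> trees n"
  obtains R where "R \<in> spanning_rels V n" "cone R = B"
proof -
  have B: "sptree B" "card {e \<in> B. r \<in> e} = n"
    using assms by (auto simp: trees_def)
  have W: "insert r (pverts V) - {r} = pverts V"
    using r_notin by auto
  obtain f and d :: "'a \<Rightarrow> nat" where
    d: "\<And>x. x \<in> insert r (pverts V) \<Longrightarrow> x \<noteq> r \<Longrightarrow> d (f x) < d x"
    and inj: "inj_on (\<lambda>x. {x, f x}) (pverts V)" and Beq: "B = (\<lambda>x. {x, f x}) ` pverts V"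
    using sptree_orientation[OF B(1)] unfolding W by blast
  define R where "R = {(x, f x) | x. x \<in> pverts V \<and> f x \<noteq> r}"
  \<comment> \<open>The edge from \<open>x\<close> to its parent is not a spoke; it comes from some
    arc of \<open>V\<close>, and \<open>arcs_sym\<close> supplies the direction needed.\<close>
  have arcs: "(x, f x) \<in> parcs V" if "x \<in> pverts V" "f x \<noteq> r" for x
  proof -
    have "{x, f x} \<in> undirected (parcs V) \<union> spokes (pverts V)"
      using B(1) that(1) by (auto simp: Beq sptree_def)
    moreover have "{x, f x} \<notin> spokes (pverts V)"
      using that r_notin by (auto simp: spokes_def doubleton_eq_iff)
    ultimately show ?thesis
      using arcs_sym by (auto simp: doubleton_in_undirected)
  qed
  then have R: "R \<subseteq> parcs V" by (auto simp: R_def)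
  have "d (f x) < d x" if "x \<in> pverts V" for x
    using d[of x] that r_notin by auto
  then have "acyclic R"
    by (intro acyclic_rank[of R d]) (auto simp: R_def)
  then have R': "forest_rel (pverts V) R"
    using pair_finite_verts R wellformed' by (auto simp: forest_rel_def R_def single_valued_def)
  have "cone R = B"
  proof -
    have "pverts V - Domain R = {x \<in> pverts V. f x = r}"
      by (auto simp: R_def)
    moreover have "undirected R = (\<lambda>x. {x, f x}) ` {x \<in> pverts V. f x \<noteq> r}"
      by (auto simp: R_def undirected_def image_iff)
    moreover have "spokes {x \<in> pverts V. f x = r} = (\<lambda>x. {x, f x}) ` {x \<in> pverts V. f x = r}"
      by (auto simp: spokes_def image_iff insert_commute)
    ultimately show ?thesis
      by (auto simp: cone_def Beq)
  qed
  moreover have "card (pverts V - Domain R) = n"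
  proof -
    \<comment> \<open>The level of \<open>R\<close> is read off its cone, by applying
      \<open>cone_in_trees\<close> at whatever level \<open>R\<close> has.\<close>
    have "R \<in> spanning_rels V (card (pverts V - Domain R))"
      using R R' by (simp add: spanning_rels_def)
    from cone_in_trees[OF this] \<open>cone R = B\<close> B(2) show ?thesis
      by (simp add: trees_def)
  qed
  ultimately show thesis
    using R R' that[of R] by (simp add: spanning_rels_def)
qed

lemma min_trees_eq_cones: "min_trees n = cone ` min_rels V v n"
proof (intro equalityI subsetI)
  fix B assume B: "B \<in> min_trees n"
  obtain R where R: "R \<in> spanning_rels V n" "cone R = B"
    using trees_imp_cone[OF min_treesD(1)[OF B]] by blast
  have "sum v R \<le> sum v S" if S: "S \<in> spanning_rels V n" for S
    using min_trees_le[OF B cone_in_trees[OF S]] R(2) sum_cone_weight[OF R(1)] sum_cone_weight[OF S]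
    by simp
  with R show "B \<in> cone ` min_rels V v n"
    by (auto simp: min_rels_def)
next
  fix B assume "B \<in> cone ` min_rels V v n"
  then obtain R where R: "R \<in> min_rels V v n" "B = cone R" by blast
  have "sum w B \<le> sum w C" if C: "C \<in> trees n" for C
  proof -
    obtain S where S: "S \<in> spanning_rels V n" "cone S = C"
      using trees_imp_cone[OF C] by blast
    with R have "sum v R \<le> sum v S" by (auto simp: min_rels_def)
    then show ?thesis
      using R(2) S sum_cone_weight[OF S(1)] sum_cone_weight[OF min_relsD(1)[OF R(1)]] by simp
  qed
  with R cone_in_trees[OF min_relsD(1)[OF R(1)]] show "B \<in> min_trees n"
    by (simp add: min_trees_def)
qed

lemma inseparable_eq_cohesion_class:
  assumes "min_rels V v k \<noteq> {}" "x \<in> pverts V"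
  shows "inseparable k `` {x} = cohesion_class V v k x"
proof -
  have nr: "{e \<in> cone R. r \<notin> e} = undirected R" if "R \<in> min_rels V v k" for R
    by (rule cone_parts(1)[OF forest_relD(2)[OF min_relsD(2)[OF that]]])
  then have "inseparable k = {(x, y). \<forall>R\<in>min_rels V v k. (x, y) \<in> linked (undirected R)}"
    by (auto simp: inseparable_def min_trees_eq_cones)
  moreover have "y \<in> pverts V" if "\<forall>R\<in>min_rels V v k. (x, y) \<in> linked (undirected R)" for y
    using assms that linked_undirected_closed[OF _ forest_relD(2)[OF min_relsD(2)] assms(2)] by blast
  ultimately show ?thesis
    by (auto simp: cohesion_class_def)
qed

text \<open>The restriction of a forest is a forest. It is connected on \<open>E\<close> because
  \<open>min_tree_links_inseparable\<close> gives links by edges inside \<open>E\<close>, and a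
  connected forest has one root.\<close>

lemma min_rel_tree_on_class:
  assumes strict: "strictly_convex_at k" and "n \<le> k" and ne: "min_rels V v k \<noteq> {}"
    and R: "R \<in> min_rels V v n" and x: "x \<in> pverts V"
  defines "E \<equiv> cohesion_class V v k x"
  shows "forest_rel E (R \<inter> E \<times> E)" "card (E - Domain (R \<inter> E \<times> E)) = 1"
proof -
  let ?S = "R \<inter> E \<times> E"
  have E: "E \<subseteq> pverts V" "x \<in> E"
    using x by (auto simp: E_def cohesion_class_def)
  note R' = forest_relD[OF min_relsD(2)[OF R]]
  show S: "forest_rel E ?S"
    by (rule forest_rel_subset[OF min_relsD(2)[OF R] E(1)]) auto
  have xy: "(x, y) \<in> linked (undirected ?S)" if "y \<in> E" for y
  proof -
    have "(x, y) \<in> inseparable k"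
      using that inseparable_eq_cohesion_class[OF ne x] by (auto simp: E_def)
    moreover have "min_trees k \<noteq> {}" "cone R \<in> min_trees n"
      using ne R by (auto simp: min_trees_eq_cones)
    ultimately have "(x, y) \<in> linked {e \<in> {e \<in> cone R. r \<notin> e}. e \<subseteq> inseparable k `` {x}}"
      using min_tree_links_inseparable[OF strict \<open>n \<le> k\<close>] by blast
    moreover have "{e \<in> {e \<in> cone R. r \<notin> e}. e \<subseteq> inseparable k `` {x}} \<subseteq> undirected ?S"
      unfolding cone_parts(1)[OF R'(2)] inseparable_eq_cohesion_class[OF ne x] E_def[symmetric]
      by (auto simp: undirected_def)
    ultimately show ?thesis
      by (rule linked_mono[rotated])
  qed
  obtain s where s: "s \<in> E - Domain ?S"
    using forest_rel_root[OF S E(2)] by blast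
  have "t = s" if t: "t \<in> E - Domain ?S" for t
  proof (rule linked_roots_eq[OF _ forest_relD(5)[OF S]])
    show "(t, s) \<in> linked (undirected ?S)"
      using xy s t by (meson DiffD1 linked_sym linked_trans)
  qed (use s t in auto)
  with s have "E - Domain ?S = {s}" by blast
  then show "card (E - Domain ?S) = 1" by simp
qed

lemma strictly_convex_atI:
  assumes "1 \<le> k" "min_rels V v k \<noteq> {}"
    and gap: "phi V v (k - 1) - phi V v k > phi V v k - phi V v (k + 1)"
  shows "strictly_convex_at k"
  unfolding strictly_convex_at_def
proof (intro conjI ballI)
  fix A F B assume A: "A \<in> trees (k - 1)" and F: "F \<in> min_trees k" and B: "B \<in> trees (k + 1)"
  have wf: "pair_wf_digraph V" by unfold_locales
  obtain a where a: "a \<in> spanning_rels V (k - 1)" "A = cone a"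
    using trees_imp_cone[OF A] by metis
  obtain f where f: "f \<in> min_rels V v k" "F = cone f"
    using F by (auto simp: min_trees_eq_cones)
  obtain b where b: "b \<in> spanning_rels V (k + 1)" "B = cone b"
    using trees_imp_cone[OF B] by metis
  obtain b' where b': "b' \<in> min_rels V v (k + 1)"
    using min_rels_nonempty[OF pair_finite_arcs] b(1) by blast
  \<comment> \<open>At level \<open>k - 1\<close> an upper bound suffices; at level
    \<open>k + 1\<close> a minimum \<open>b'\<close> exists because \<open>b\<close> does.\<close>
  have "phi V v (k - 1) \<le> ereal (sum v a)"
    unfolding phi_eq[OF wf] using a(1) by (rule INF_lower)
  then have "phi V v (k - 1) - phi V v k \<le> ereal (sum v a - sum v f)"
    unfolding phi_min_rels[OF wf f(1)] by (cases "phi V v (k - 1)") auto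
  from less_le_trans[OF gap this] have "ereal (sum v f - sum v b') < ereal (sum v a - sum v f)"
    unfolding phi_min_rels[OF wf f(1)] phi_min_rels[OF wf b'] by simp
  moreover have "sum v b' \<le> sum v b"
    using b' b(1) by (auto simp: min_rels_def)
  ultimately have "2 * sum v f < sum v a + sum v b" by simp
  then show "2 * sum w F < sum w A + sum w B"
    using sum_cone_weight[OF a(1)] sum_cone_weight[OF b(1)] sum_cone_weight[OF min_relsD(1)[OF f(1)]]
    by (simp add: a(2) b(2) f(2))
qed (rule assms(1))

end

section \<open>Gluing trees along a forest of the condensation\<close>

text \<open>\<open>P\<close> partitions \<open>X\<close>, each \<open>T A\<close> is a tree with
  root \<open>\<rho> A\<close>, and \<open>D\<close> holds the classes whose root gets an arc
  \<open>link A\<close> to another class. Acyclicity across classes is left open: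
  \<open>forest_rel_glued\<close> and \<open>forest_rel_quotient\<close> transfer it between
  \<open>quotient_rel\<close> and \<open>glued\<close>, one for each inequality of (b).\<close>

locale glued_forest =
  fixes X :: "'a set" and P :: "'a set set" and T :: "'a set \<Rightarrow> 'a rel" and \<rho> :: "'a set \<Rightarrow> 'a"
    and D :: "'a set set" and link :: "'a set \<Rightarrow> 'a \<times> 'a"
  assumes fin: "finite X" and cover: "\<Union>P = X"
    and disj: "\<And>A B x. A \<in> P \<Longrightarrow> B \<in> P \<Longrightarrow> x \<in> A \<Longrightarrow> x \<in> B \<Longrightarrow> A = B"
    and T: "\<And>A. A \<in> P \<Longrightarrow> forest_rel A (T A)"
    and \<rho>: "\<And>A. A \<in> P \<Longrightarrow> A - Domain (T A) = {\<rho> A}"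
    and D: "D \<subseteq> P"
    and link: "\<And>A. A \<in> D \<Longrightarrow> fst (link A) = \<rho> A \<and> snd (link A) \<in> X - A"
begin

definition glued :: "'a rel" where
  "glued = (\<Union>A\<in>P. T A) \<union> link ` D"

definition quotient_rel :: "'a set rel" where
  "quotient_rel = {(A, B). A \<in> D \<and> B \<in> P \<and> snd (link A) \<in> B}"

lemma finite_P: "finite P"
proof (rule finite_subset)
  show "P \<subseteq> Pow X" using cover by blast
qed (use fin in simp)

lemma finite_D: "finite D"
  using D finite_P finite_subset by blast

lemma T_sub: "A \<in> P \<Longrightarrow> T A \<subseteq> A \<times> A"
  using forest_relD(2)[OF T] .

lemma P_sub: "A \<in> P \<Longrightarrow> A \<subseteq> X"
  using cover by blast

lemma \<rho>_in: "A \<in> P \<Longrightarrow> \<rho> A \<in> A" "A \<in> P \<Longrightarrow> \<rho> A \<notin> Domain (T A)"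
  using \<rho>[of A] by blast+

lemma link_eq: "A \<in> D \<Longrightarrow> link A = (\<rho> A, snd (link A))"
  using link[of A] by (metis prod.collapse)

lemma inj_link: "inj_on link D"
proof (rule inj_onI)
  fix A B assume *: "A \<in> D" "B \<in> D" "link A = link B"
  then have "\<rho> A = \<rho> B" using link[of A] link[of B] by simp
  then show "A = B" using * D disj[of A B "\<rho> A"] \<rho>_in(1)[of A] \<rho>_in(1)[of B] by auto
qed

lemma glued_cases:
  assumes "(x, y) \<in> glued"
  obtains (inner) A where "A \<in> P" "(x, y) \<in> T A" "x \<in> A" "y \<in> A" "x \<noteq> \<rho> A"
  | (outer) A where "A \<in> D" "A \<in> P" "x = \<rho> A" "x \<in> A" "y = snd (link A)" "y \<in> X" "y \<notin> A"
proof -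
  from assms consider A where "A \<in> P" "(x, y) \<in> T A" | A where "A \<in> D" "(x, y) = link A"
    by (auto simp: glued_def)
  then show thesis
  proof cases
    case 1
    then have "x \<in> A" "y \<in> A" "x \<noteq> \<rho> A"
      using T_sub[of A] \<rho>_in(2)[of A] by auto
    with 1 inner show thesis by blast
  next
    case 2
    then have "A \<in> P" using D by blast
    moreover have "x = fst (link A)" "y = snd (link A)"
      using arg_cong[OF 2(2), of fst] arg_cong[OF 2(2), of snd] by simp_all
    ultimately have "x = \<rho> A" "x \<in> A" "y = snd (link A)" "y \<in> X" "y \<notin> A"
      using link[OF 2(1)] \<rho>_in(1)[of A] by simp_all
    with 2(1) \<open>A \<in> P\<close> outer show thesis by blast
  qed
qed

lemma glued_sub: "glued \<subseteq> X \<times> X"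
proof (rule subrelI)
  fix x y assume "(x, y) \<in> glued"
  then show "(x, y) \<in> X \<times> X"
    by (cases rule: glued_cases) (use P_sub in blast)+
qed

lemma sum_glued:
  fixes g :: "'a \<times> 'a \<Rightarrow> 'b::comm_monoid_add"
  shows "sum g glued = (\<Sum>A\<in>P. sum g (T A)) + (\<Sum>A\<in>D. g (link A))"
proof -
  have finT: "finite (T A)" if "A \<in> P" for A
    using forest_relD(3)[OF T[OF that]] .
  \<comment> \<open>A link starts at the root of its class, and no tree arc leaves a root.\<close>
  have "e \<notin> link ` D" if "A \<in> P" "e \<in> T A" for A e
  proof
    assume "e \<in> link ` D"
    then obtain B where B: "B \<in> D" "e = link B" by blast
    then have "(\<rho> B, snd (link B)) \<in> T A"
      using that(2) link_eq[of B] by simp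
    then have "\<rho> B \<in> A" "\<rho> B \<in> Domain (T A)"
      using T_sub[OF that(1)] by blast+
    then show False
      using B D that disj[of A B "\<rho> B"] \<rho>_in[of B] by blast
  qed
  then have "sum g glued = sum g (\<Union>A\<in>P. T A) + sum g (link ` D)"
    unfolding glued_def using finite_P finite_D finT by (intro sum.union_disjoint) auto
  also have "sum g (\<Union>A\<in>P. T A) = (\<Sum>A\<in>P. sum g (T A))"
  proof (rule sum.UNION_disjoint)
    show "\<forall>A\<in>P. \<forall>B\<in>P. A \<noteq> B \<longrightarrow> T A \<inter> T B = {}"
      using T_sub disj by fast
  qed (use finite_P finT in auto)
  also have "sum g (link ` D) = (\<Sum>A\<in>D. g (link A))"
    by (simp add: sum.reindex[OF inj_link])
  finally show ?thesis .
qed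

lemma glued_roots: "X - Domain glued = \<rho> ` (P - D)"
proof (intro equalityI subsetI)
  fix x assume x: "x \<in> X - Domain glued"
  then obtain A where A: "A \<in> P" "x \<in> A" using cover by blast
  have "x \<notin> Domain (T A)" using A x by (auto simp: glued_def)
  with A \<rho> have "x = \<rho> A" by blast
  moreover have "A \<notin> D"
  proof
    assume "A \<in> D"
    then have "(\<rho> A, snd (link A)) \<in> glued"
      using link_eq[of A] by (auto simp: glued_def)
    with x \<open>x = \<rho> A\<close> show False by blast
  qed
  ultimately show "x \<in> \<rho> ` (P - D)" using A by blast
next
  fix x assume "x \<in> \<rho> ` (P - D)"
  then obtain A where A: "A \<in> P" "A \<notin> D" "x = \<rho> A" by blast
  have "(x, y) \<notin> glued" for y
  proof
    assume "(x, y) \<in> glued"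
    then show False
    proof (cases rule: glued_cases)
      case (inner B)
      with A disj[of A B x] \<rho>_in(1)[of A] show False by blast
    next
      case (outer B)
      with A disj[of A B x] \<rho>_in(1)[of A] show False by blast
    qed
  qed
  then show "x \<in> X - Domain glued"
    using A \<rho>_in(1)[of A] P_sub by blast
qed

text \<open>Together with \<open>Domain quotient_rel = D\<close> this gives \<open>glued\<close> and
  \<open>quotient_rel\<close> the same number of trees.\<close>

lemma card_glued_roots: "card (X - Domain glued) = card (P - D)"
  unfolding glued_roots
proof (rule card_image, rule inj_onI)
  fix A B assume "A \<in> P - D" "B \<in> P - D" "\<rho> A = \<rho> B"
  then show "A = B" using disj[of A B "\<rho> A"] \<rho>_in(1)[of A] \<rho>_in(1)[of B] by auto
qed

lemma quotient_props:
  shows "single_valued quotient_rel" "Domain quotient_rel = D" "quotient_rel \<subseteq> P \<times> P"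
proof -
  show "single_valued quotient_rel"
    using disj by (auto simp: single_valued_def quotient_rel_def)
  show "quotient_rel \<subseteq> P \<times> P"
    using D by (auto simp: quotient_rel_def)
  have "\<exists>B\<in>P. snd (link A) \<in> B" if "A \<in> D" for A
    using link[OF that] cover by blast
  then show "Domain quotient_rel = D"
    by (auto simp: quotient_rel_def)
qed

lemma single_valued_glued: "single_valued glued"
proof (rule single_valuedI)
  fix x y z assume xy: "(x, y) \<in> glued" and xz: "(x, z) \<in> glued"
  from xy show "y = z"
  proof (cases rule: glued_cases)
    case (inner A)
    note A = this
    from xz show ?thesis
    proof (cases rule: glued_cases)
      case (inner B)
      with A have "B = A" using disj by blast
      with A inner forest_relD(5)[OF T[of A]] show ?thesis
        by (auto simp: single_valued_def)
    next
      case (outer B)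
      with A disj show ?thesis by blast
    qed
  next
    case (outer A)
    note A = this
    from xz show ?thesis
    proof (cases rule: glued_cases)
      case (inner B)
      with A disj show ?thesis by blast
    next
      case (outer B)
      with A disj have "A = B" by blast
      with A outer show ?thesis by simp
    qed
  qed
qed

text \<open>A lexicographic rank: first the rank of the class in the quotient, which links decrease,
  then the rank inside the tree, which inner arcs decrease.\<close>

lemma acyclic_glued:
  assumes "forest_rel P quotient_rel"
  shows "acyclic glued"
proof -
  obtain q :: "'a set \<Rightarrow> nat" where q: "\<And>A B. (A, B) \<in> quotient_rel \<Longrightarrow> q B < q A"
    using forest_rel_rank[OF assms] by blast
  have "\<exists>d :: 'a \<Rightarrow> nat. \<forall>x y. (x, y) \<in> T A \<longrightarrow> d y < d x" if "A \<in> P" for A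
    using forest_rel_rank[OF T[OF that]] by metis
  then obtain d :: "'a set \<Rightarrow> 'a \<Rightarrow> nat"
    where d: "\<And>A x y. A \<in> P \<Longrightarrow> (x, y) \<in> T A \<Longrightarrow> d A y < d A x"
    by metis
  define cl where "cl x = (THE A. A \<in> P \<and> x \<in> A)" for x
  have cl: "cl x = A" if "A \<in> P" "x \<in> A" for x A
    unfolding cl_def using that disj by (intro the_equality) auto
  let ?L = "inv_image (less_than <*lex*> less_than) (\<lambda>x. (q (cl x), d (cl x) x))"
  have "glued \<subseteq> ?L\<inverse>"
  proof (rule subrelI)
    fix x y assume "(x, y) \<in> glued"
    then show "(x, y) \<in> ?L\<inverse>"
    proof (cases rule: glued_cases)
      case (inner A)
      then show ?thesis using d cl by (auto simp: in_lex_prod)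
    next
      case (outer A)
      obtain B where B: "B \<in> P" "y \<in> B" using outer cover by blast
      with outer have "(A, B) \<in> quotient_rel" by (auto simp: quotient_rel_def)
      from q[OF this] show ?thesis using B outer cl by auto
    qed
  qed
  moreover have "wf ?L" by (intro wf_inv_image wf_lex_prod wf_less_than)
  ultimately show ?thesis
    by (meson acyclic_converse acyclic_subset wf_acyclic)
qed

lemma forest_rel_glued:
  assumes "forest_rel P quotient_rel"
  shows "forest_rel X glued"
  using acyclic_glued[OF assms] single_valued_glued glued_sub fin by (simp add: forest_rel_def)

text \<open>A class is ranked by its root in \<open>glued\<close>. The link from \<open>A\<close>
  enters \<open>B\<close> and the tree arcs then lead down to \<open>\<rho> B\<close>, so the rank
  drops along each quotient arc.\<close>

lemma forest_rel_quotient: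
  assumes "forest_rel X glued"
  shows "forest_rel P quotient_rel"
proof -
  obtain d :: "'a \<Rightarrow> nat" where d: "\<And>x y. (x, y) \<in> glued \<Longrightarrow> d y < d x"
    using forest_rel_rank[OF assms] by blast
  have "d (\<rho> B) < d (\<rho> A)" if AB: "(A, B) \<in> quotient_rel" for A B
  proof -
    from AB have *: "A \<in> D" "B \<in> P" "snd (link A) \<in> B"
      by (auto simp: quotient_rel_def)
    obtain s where s: "s \<in> B - Domain (T B)" "(snd (link A), s) \<in> (T B)\<^sup>*"
      using forest_rel_root[OF T[OF *(2)] *(3)] by blast
    have "s = \<rho> B" using s(1) \<rho>[OF *(2)] by blast
    have "d s \<le> d (snd (link A))"
      using s(2)
    proof (induction rule: rtrancl_induct)
      case (step y z)
      then have "(y, z) \<in> glued" using *(2) by (auto simp: glued_def)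
      from d[OF this] step.IH show ?case by simp
    qed simp
    moreover have "d (snd (link A)) < d (\<rho> A)"
      using *(1) link_eq[of A] by (intro d) (auto simp: glued_def)
    ultimately show ?thesis using \<open>s = \<rho> B\<close> by simp
  qed
  then have "acyclic quotient_rel" by (rule acyclic_rank)
  with quotient_props finite_P show ?thesis by (simp add: forest_rel_def)
qed

lemma sum_over_D:
  fixes g :: "'a set \<Rightarrow> 'b::comm_monoid_add"
  shows "(\<Sum>(A, B)\<in>quotient_rel. g A) = sum g D"
  using sum_Domain[OF quotient_props(1), of g] by (simp add: quotient_props(2))

lemma sum_trees_split:
  fixes g :: "'a set \<Rightarrow> 'b::comm_monoid_add"
  shows "sum g P = sum g (P - D) + sum g D"
  by (rule sum.subset_diff[OF D finite_P])

end

section \<open>Trees on vertex classes and the weights of the condensation\<close>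

definition sub_digraph :: "'a pair_pre_digraph \<Rightarrow> 'a set \<Rightarrow> 'a pair_pre_digraph" where
  "sub_digraph G A = \<lparr> pverts = A, parcs = parcs G \<inter> A \<times> A \<rparr>"

definition rooted_rels :: "'a pair_pre_digraph \<Rightarrow> 'a set \<Rightarrow> 'a \<Rightarrow> 'a rel set" where
  "rooted_rels G A i = {S \<in> spanning_rels (sub_digraph G A) 1. i \<in> A - Domain S}"

lemma pair_wf_sub_digraph: "pair_wf_digraph (sub_digraph G A)"
  by unfold_locales (auto simp: sub_digraph_def)

lemma spanning_rels_sub_digraph:
  "S \<in> spanning_rels (sub_digraph G A) 1 \<longleftrightarrow>
    S \<subseteq> parcs G \<and> forest_rel A S \<and> card (A - Domain S) = 1"
  using forest_relD(2)[of A S] by (auto simp: spanning_rels_def sub_digraph_def)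

lemma spanning_trees_induced:
  "spanning_trees (with_proj G \<restriction> A) = digr A ` spanning_rels (sub_digraph G A) 1"
  using spanning_trees_eq[OF pair_wf_sub_digraph, of G A] by (simp add: induce_digr sub_digraph_def)

lemma rooted_spanning_trees_induced:
  "rooted_spanning_trees (with_proj G \<restriction> A) i = digr A ` rooted_rels G A i"
proof -
  have "i \<in> roots (digr A S) \<longleftrightarrow> i \<in> A - Domain S" if "S \<in> spanning_rels (sub_digraph G A) 1" for S
    using iffD1[OF spanning_rels_sub_digraph that] roots_digr[OF forest_relD(3), of A S A] by simp
  then show ?thesis
    unfolding rooted_spanning_trees_def spanning_trees_induced rooted_rels_def by auto
qed

lemma min_tree_weight_induced:
  "min_tree_weight (with_proj G \<restriction> A) v =
    (INF S\<in>spanning_rels (sub_digraph G A) 1. ereal (sum v S))"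
  unfolding min_tree_weight_def spanning_trees_induced image_image arc_weight_digr ..

context pair_fin_digraph
begin

lemma finite_rooted_rels: "finite (rooted_rels G A i)"
  by (rule finite_subset[OF _ finite_spanning_rels[of "sub_digraph G A" 1]])
    (auto simp: rooted_rels_def sub_digraph_def pair_finite_arcs)

lemma linking_arcs_iff:
  "(i, j) \<in> linking_arcs G A B \<longleftrightarrow> (i, j) \<in> parcs G \<and> i \<in> A \<and> j \<in> B \<and> rooted_rels G A i \<noteq> {}"
  by (simp add: linking_arcs_def rooted_spanning_trees_induced)

lemma finite_linking_arcs: "finite (linking_arcs G A B)"
  by (rule finite_subset[OF _ pair_finite_arcs]) (auto simp: linking_arcs_iff)

lemma condensation_weight_eq:
  "condensation_weight G v (A, B) =
    Min ((\<lambda>(i, j). Min (sum v ` rooted_rels G A i) + v (i, j)) ` linking_arcs G A B)"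
  by (simp add: condensation_weight_def rooted_spanning_trees_induced image_image arc_weight_digr)

lemma condensation_weight_le:
  assumes "(i, j) \<in> parcs G" "i \<in> A" "j \<in> B" "S \<in> rooted_rels G A i"
  shows "condensation_weight G v (A, B) \<le> sum v S + v (i, j)"
proof -
  have "(i, j) \<in> linking_arcs G A B"
    using assms by (auto simp: linking_arcs_iff)
  then have "condensation_weight G v (A, B) \<le> Min (sum v ` rooted_rels G A i) + v (i, j)"
    unfolding condensation_weight_eq using finite_linking_arcs by (intro Min_le) (auto intro!: image_eqI)
  moreover have "Min (sum v ` rooted_rels G A i) \<le> sum v S"
    using finite_rooted_rels assms(4) by (intro Min_le) auto
  ultimately show ?thesis by simp
qed

text \<open>Both nested minima run over finite nonempty sets, so one tree and one arc attain them
  together.\<close>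

lemma condensation_weight_attained:
  assumes "linking_arcs G A B \<noteq> {}"
  obtains i j S where "(i, j) \<in> parcs G" "i \<in> A" "j \<in> B" "S \<in> rooted_rels G A i"
    "condensation_weight G v (A, B) = sum v S + v (i, j)"
proof -
  let ?f = "\<lambda>(i, j). Min (sum v ` rooted_rels G A i) + v (i, j)"
  have "condensation_weight G v (A, B) \<in> ?f ` linking_arcs G A B"
    unfolding condensation_weight_eq using assms finite_linking_arcs by (intro Min_in) auto
  then obtain i j where ij: "(i, j) \<in> linking_arcs G A B"
    "condensation_weight G v (A, B) = Min (sum v ` rooted_rels G A i) + v (i, j)"
    by auto
  then have "Min (sum v ` rooted_rels G A i) \<in> sum v ` rooted_rels G A i"
    using finite_rooted_rels by (intro Min_in) (auto simp: linking_arcs_iff)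
  then obtain S where "S \<in> rooted_rels G A i" "Min (sum v ` rooted_rels G A i) = sum v S"
    by blast
  with ij that show thesis
    by (auto simp: linking_arcs_iff)
qed

end

lemma condensation_forest_weight_digr:
  assumes "finite \<Phi>"
  shows "condensation_forest_weight G v (digr P \<Phi>) =
    ereal (sum (condensation_weight G v) \<Phi>)
      + (\<Sum>A\<in>P - Domain \<Phi>. min_tree_weight (with_proj G \<restriction> A) v)"
  by (simp add: condensation_forest_weight_def arc_weight_digr roots_digr[OF assms])

lemma (in pair_fin_digraph) min_tree_weight_attained:
  assumes "spanning_rels (sub_digraph G A) 1 \<noteq> {}"
  obtains S where "S \<in> spanning_rels (sub_digraph G A) 1"
    "min_tree_weight (with_proj G \<restriction> A) v = ereal (sum v S)"
proof -
  have "finite (parcs (sub_digraph G A))"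
    using pair_finite_arcs by (simp add: sub_digraph_def)
  from min_rels_nonempty[OF this assms] obtain S where S: "S \<in> min_rels (sub_digraph G A) v 1"
    by blast
  have "min_tree_weight (with_proj G \<restriction> A) v = phi (with_proj (sub_digraph G A)) v 1"
    by (simp only: min_tree_weight_induced phi_eq[OF pair_wf_sub_digraph])
  with phi_min_rels[OF pair_wf_sub_digraph S] min_relsD(1)[OF S] that show thesis
    by simp
qed

section \<open>Comparison of \<open>phi\<close> with \<open>condensation_phi\<close>\<close>

context pair_fin_digraph
begin

lemma condensation_simps:
  "pverts (condensation G v k) = cohesion_class G v k ` pverts G"
  "parcs (condensation G v k) = {(A, B) \<in> (cohesion_class G v k ` pverts G) \<times> (cohesion_class G v k ` pverts G).
     A \<noteq> B \<and> linking_arcs G A B \<noteq> {}}"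
  using elementary_sets_aleph[OF pair_fin_digraph_axioms, of v k]
  by (simp_all add: condensation_def Let_def)

lemma pair_wf_condensation: "pair_wf_digraph (condensation G v k)"
  by unfold_locales (auto simp: condensation_simps)

lemma condensation_phi_eq:
  "condensation_phi G v k n = (INF \<Phi>\<in>spanning_rels (condensation G v k) n.
     condensation_forest_weight G v (digr (cohesion_class G v k ` pverts G) \<Phi>))"
  unfolding condensation_phi_def spanning_forests_eq[OF pair_wf_condensation] image_image
  by (simp add: condensation_simps(1))

lemma classes_disjoint:
  assumes "A \<in> cohesion_class G v k ` pverts G" "B \<in> cohesion_class G v k ` pverts G"
    "x \<in> A" "x \<in> B"
  shows "A = B"
  using assms cohesion_class_eq by (metis imageE)

lemma classes_cover: "\<Union> (cohesion_class G v k ` pverts G) = pverts G"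
  using cohesion_class_self[of _ G v k] by (fastforce simp: cohesion_class_def)

text \<open>Every forest of the condensation lifts to a forest of the same weight in
  \<open>G\<close>: in a non-root class take a tree and an arc attaining the weight of the condensed
  arc, in a root class a lightest tree, and glue.\<close>

lemma phi_le_condensation_phi:
  assumes trees: "\<And>A. A \<in> cohesion_class G v k ` pverts G \<Longrightarrow> spanning_rels (sub_digraph G A) 1 \<noteq> {}"
  shows "phi (with_proj G) v n \<le> condensation_phi G v k n"
  unfolding condensation_phi_eq
proof (rule INF_greatest)
  let ?P = "cohesion_class G v k ` pverts G"
  fix \<Phi> assume "\<Phi> \<in> spanning_rels (condensation G v k) n"
  then have \<Phi>: "\<Phi> \<subseteq> parcs (condensation G v k)" "forest_rel ?P \<Phi>" "card (?P - Domain \<Phi>) = n"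
    by (auto simp: spanning_rels_def condensation_simps(1))
  note \<Phi>' = forest_relD[OF \<Phi>(2)]
  \<comment> \<open>The choice depends on \<open>A\<close> alone, since \<open>\<Phi>\<close> has at
    most one arc out of \<open>A\<close>; for a root class \<open>l\<close> is arbitrary.\<close>
  have "\<exists>S l. S \<in> spanning_rels (sub_digraph G A) 1 \<and>
      (A \<notin> Domain \<Phi> \<longrightarrow> min_tree_weight (with_proj G \<restriction> A) v = ereal (sum v S)) \<and>
      (\<forall>B. (A, B) \<in> \<Phi> \<longrightarrow> l \<in> parcs G \<and> fst l \<in> A - Domain S \<and> snd l \<in> B \<and>
         condensation_weight G v (A, B) = sum v S + v l)" if A: "A \<in> ?P" for A
  proof (cases "A \<in> Domain \<Phi>")
    case True
    then obtain B where B: "(A, B) \<in> \<Phi>" by blast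
    with \<Phi>(1) have "linking_arcs G A B \<noteq> {}" by (auto simp: condensation_simps(2))
    from condensation_weight_attained[OF this] obtain i j S where
      *: "(i, j) \<in> parcs G" "i \<in> A" "j \<in> B" "S \<in> rooted_rels G A i"
      "condensation_weight G v (A, B) = sum v S + v (i, j)" by blast
    have "B' = B" if "(A, B') \<in> \<Phi>" for B'
      using that B \<Phi>'(5) by (auto simp: single_valued_def)
    with * True show ?thesis
      by (intro exI[of _ S] exI[of _ "(i, j)"]) (auto simp: rooted_rels_def)
  next
    case False
    obtain S where "S \<in> spanning_rels (sub_digraph G A) 1"
      "min_tree_weight (with_proj G \<restriction> A) v = ereal (sum v S)"
      using min_tree_weight_attained[OF trees[OF A]] by blast
    with False show ?thesis by (intro exI[of _ S]) blast
  qed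
  then obtain T link where
    T: "\<And>A. A \<in> ?P \<Longrightarrow> T A \<in> spanning_rels (sub_digraph G A) 1"
    and Tmin: "\<And>A. A \<in> ?P \<Longrightarrow> A \<notin> Domain \<Phi> \<Longrightarrow> min_tree_weight (with_proj G \<restriction> A) v = ereal (sum v (T A))"
    and link: "\<And>A B. A \<in> ?P \<Longrightarrow> (A, B) \<in> \<Phi> \<Longrightarrow> link A \<in> parcs G \<and> fst (link A) \<in> A - Domain (T A)
      \<and> snd (link A) \<in> B \<and> condensation_weight G v (A, B) = sum v (T A) + v (link A)"
    by metis
  have T': "T A \<subseteq> parcs G" "forest_rel A (T A)" "card (A - Domain (T A)) = 1" if "A \<in> ?P" for A
    using T[OF that] unfolding spanning_rels_sub_digraph by blast+
  define \<rho> where "\<rho> A = the_elem (A - Domain (T A))" for A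
  have \<rho>: "A - Domain (T A) = {\<rho> A}" if "A \<in> ?P" for A
    using T'(3)[OF that] unfolding \<rho>_def by (metis card_1_singletonE the_elem_eq)
  have dom: "Domain \<Phi> \<subseteq> ?P" using \<Phi>'(2) by blast
  have linkD: "fst (link A) = \<rho> A \<and> snd (link A) \<in> pverts G - A" if A: "A \<in> Domain \<Phi>" for A
  proof -
    obtain B where B: "(A, B) \<in> \<Phi>" using A by blast
    then have AB: "A \<in> ?P" "B \<in> ?P" "A \<noteq> B" using \<Phi>(1) by (auto simp: condensation_simps(2))
    from link[OF AB(1) B] \<rho>[OF AB(1)] have *: "fst (link A) = \<rho> A" "snd (link A) \<in> B" by auto
    moreover have "snd (link A) \<in> pverts G" using * AB(2) classes_cover by blast
    moreover have "snd (link A) \<notin> A" using classes_disjoint[OF AB(1,2)] AB(3) *(2) by blast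
    ultimately show ?thesis by blast
  qed
  interpret gf: glued_forest "pverts G" ?P T \<rho> "Domain \<Phi>" link
    by (rule glued_forest.intro) (fact pair_finite_verts classes_cover classes_disjoint T'(2) \<rho> dom linkD)+
  have "gf.quotient_rel = \<Phi>"
  proof (intro equalityI subrelI)
    fix A B assume "(A, B) \<in> \<Phi>"
    with \<Phi>'(2) link show "(A, B) \<in> gf.quotient_rel" by (auto simp: gf.quotient_rel_def)
  next
    fix A B assume "(A, B) \<in> gf.quotient_rel"
    then have AB: "A \<in> Domain \<Phi>" "B \<in> ?P" "snd (link A) \<in> B" by (auto simp: gf.quotient_rel_def)
    then obtain B' where B': "(A, B') \<in> \<Phi>" by blast
    with dom link[of A B'] AB(1) have "snd (link A) \<in> B'" by blast
    moreover have "B' \<in> ?P" using B' \<Phi>'(2) by blast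
    ultimately have "B' = B" using AB classes_disjoint by blast
    with B' show "(A, B) \<in> \<Phi>" by simp
  qed
  have "gf.glued \<subseteq> parcs G"
    unfolding gf.glued_def
  proof (intro Un_least UN_least image_subsetI)
    fix A assume "A \<in> Domain \<Phi>"
    then obtain B where "(A, B) \<in> \<Phi>" by blast
    with link dom show "link A \<in> parcs G" by blast
  qed (rule T'(1))
  then have "gf.glued \<in> spanning_rels G n"
    using gf.forest_rel_glued \<Phi> gf.card_glued_roots \<open>gf.quotient_rel = \<Phi>\<close> by (simp add: spanning_rels_def)
  moreover have "condensation_forest_weight G v (digr ?P \<Phi>) = ereal (sum v gf.glued)"
  proof -
    have "sum (condensation_weight G v) \<Phi> = (\<Sum>(A, B)\<in>\<Phi>. sum v (T A) + v (link A))"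
      using link dom by (intro sum.cong) auto
    also have "\<dots> = (\<Sum>A\<in>Domain \<Phi>. sum v (T A) + v (link A))"
      using gf.sum_over_D[of "\<lambda>A. sum v (T A) + v (link A)"] \<open>gf.quotient_rel = \<Phi>\<close> by simp
    finally have 1: "sum (condensation_weight G v) \<Phi> = \<dots>" .
    have 2: "(\<Sum>A\<in>?P - Domain \<Phi>. min_tree_weight (with_proj G \<restriction> A) v)
        = ereal (\<Sum>A\<in>?P - Domain \<Phi>. sum v (T A))"
      using Tmin by (subst sum_ereal[symmetric]) (intro sum.cong, auto)
    show ?thesis
      unfolding condensation_forest_weight_digr[OF \<Phi>'(3)] 1 2 gf.sum_glued
      using gf.sum_trees_split[of "\<lambda>A. sum v (T A)"] by (simp add: sum.distrib)
  qed
  ultimately show "phi (with_proj G) v n \<le> condensation_forest_weight G v (digr ?P \<Phi>)"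
    unfolding phi_eq[OF pair_wf_digraph_axioms] by (metis INF_lower)
qed

text \<open>\<open>R\<close> is cut into its trees on the classes and the arcs between classes. Each
  condensed arc weighs no more than the tree and link it replaces, and each root class no more than
  its tree.\<close>

lemma condensation_phi_le_phi:
  assumes R: "R \<in> min_rels G v n"
    and trees: "\<And>A. A \<in> cohesion_class G v k ` pverts G \<Longrightarrow>
      forest_rel A (R \<inter> A \<times> A) \<and> card (A - Domain (R \<inter> A \<times> A)) = 1"
  shows "condensation_phi G v k n \<le> phi (with_proj G) v n"
proof -
  let ?P = "cohesion_class G v k ` pverts G"
  define T where "T A = R \<inter> A \<times> A" for A
  note R' = min_relsD[OF R] and RR = forest_relD[OF min_relsD(2)[OF R]]
  have T': "T A \<subseteq> parcs G" "forest_rel A (T A)" "card (A - Domain (T A)) = 1" if "A \<in> ?P" for A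
    using trees[OF that] R'(3) by (auto simp: T_def)
  then have T: "T A \<in> spanning_rels (sub_digraph G A) 1" if "A \<in> ?P" for A
    unfolding spanning_rels_sub_digraph using that by blast
  define \<rho> where "\<rho> A = the_elem (A - Domain (T A))" for A
  have \<rho>: "A - Domain (T A) = {\<rho> A}" if "A \<in> ?P" for A
    using T'(3)[OF that] unfolding \<rho>_def by (metis card_1_singletonE the_elem_eq)
  define D where "D = {A \<in> ?P. \<rho> A \<in> Domain R}"
  \<comment> \<open>The arc of \<open>R\<close> at \<open>\<rho> A\<close> is unique; outside
    \<open>D\<close> the choice is arbitrary.\<close>
  define link where "link A = (\<rho> A, SOME j. (\<rho> A, j) \<in> R)" for A
  have link_R: "link A \<in> R" if "A \<in> D" for A
    using that unfolding D_def link_def by (auto intro: someI)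
  have linkD: "fst (link A) = \<rho> A \<and> snd (link A) \<in> pverts G - A" if A: "A \<in> D" for A
  proof -
    have "A \<in> ?P" using A by (simp add: D_def)
    with \<rho> have "\<rho> A \<in> A" "\<rho> A \<notin> Domain (T A)" by blast+
    with link_R[OF A] have "snd (link A) \<notin> A"
      by (auto simp: T_def link_def)
    moreover have "snd (link A) \<in> pverts G"
      using link_R[OF A] RR(2) by (cases "link A") auto
    ultimately show ?thesis by (simp add: link_def)
  qed
  have DP: "D \<subseteq> ?P" by (auto simp: D_def)
  interpret gf: glued_forest "pverts G" ?P T \<rho> D link
    by (rule glued_forest.intro)
      (fact pair_finite_verts classes_cover classes_disjoint T'(2) \<rho> DP linkD)+
  have "gf.glued = R"
  proof (intro equalityI subrelI)
    fix x y assume "(x, y) \<in> gf.glued"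
    then show "(x, y) \<in> R" using link_R by (auto simp: gf.glued_def T_def)
  next
    fix x y assume xy: "(x, y) \<in> R"
    with RR(2) have "x \<in> \<Union>?P"
      unfolding classes_cover by blast
    then obtain A where A: "A \<in> ?P" "x \<in> A" by (rule UnionE)
    show "(x, y) \<in> gf.glued"
    proof (cases "y \<in> A")
      case True
      then show ?thesis using A xy by (auto simp: gf.glued_def T_def)
    next
      case False
      \<comment> \<open>An arc that leaves a class starts at the root of the class: any other vertex
        already has its only arc inside.\<close>
      have "x \<notin> Domain (T A)"
        using xy False RR(5) by (auto simp: T_def single_valued_def)
      with A \<rho>[OF A(1)] have "x = \<rho> A" by blast
      with A xy have "A \<in> D" by (auto simp: D_def)
      have "link A = (x, y)"
        using link_R[OF \<open>A \<in> D\<close>] xy RR(5) \<open>x = \<rho> A\<close> by (auto simp: link_def single_valued_def)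
      with \<open>A \<in> D\<close> show ?thesis unfolding gf.glued_def by force
    qed
  qed
  have forest: "forest_rel ?P gf.quotient_rel"
    using gf.forest_rel_quotient min_relsD(2)[OF R] \<open>gf.glued = R\<close> by simp
  have rooted: "T A \<in> rooted_rels G A (\<rho> A)" if "A \<in> ?P" for A
    unfolding rooted_rels_def using T[OF that] \<rho>[OF that] by blast
  have link_arc: "(\<rho> A, snd (link A)) \<in> parcs G" "\<rho> A \<in> A" if "A \<in> D" for A
  proof -
    show "(\<rho> A, snd (link A)) \<in> parcs G"
      using link_R[OF that] gf.link_eq[OF that] R'(3) by auto
    show "\<rho> A \<in> A" using that DP gf.\<rho>_in(1) by blast
  qed
  have sub: "gf.quotient_rel \<subseteq> parcs (condensation G v k)"
  proof (rule subrelI)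
    fix A B assume "(A, B) \<in> gf.quotient_rel"
    then have AB: "A \<in> D" "A \<in> ?P" "B \<in> ?P" "snd (link A) \<in> B"
      using DP by (auto simp: gf.quotient_rel_def)
    then have "(\<rho> A, snd (link A)) \<in> linking_arcs G A B"
      using link_arc[OF AB(1)] rooted[OF AB(2)] by (auto simp: linking_arcs_iff)
    moreover have "A \<noteq> B" using AB(1,4) linkD by blast
    ultimately show "(A, B) \<in> parcs (condensation G v k)"
      using AB(2,3) unfolding condensation_simps(2) by blast
  qed
  have "card (?P - Domain gf.quotient_rel) = n"
    using gf.card_glued_roots gf.quotient_props(2) \<open>gf.glued = R\<close> R'(4) by simp
  with forest sub have mem: "gf.quotient_rel \<in> spanning_rels (condensation G v k) n"
    by (simp add: spanning_rels_def condensation_simps(1))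
  have "sum (condensation_weight G v) gf.quotient_rel
      \<le> (\<Sum>(A, B)\<in>gf.quotient_rel. sum v (T A) + v (link A))"
  proof (rule sum_mono)
    fix e assume "e \<in> gf.quotient_rel"
    then obtain A B where e: "e = (A, B)" and AB: "A \<in> D" "A \<in> ?P" "snd (link A) \<in> B"
      using DP by (cases e) (auto simp: gf.quotient_rel_def)
    have "condensation_weight G v (A, B) \<le> sum v (T A) + v (\<rho> A, snd (link A))"
      by (rule condensation_weight_le[OF link_arc[OF AB(1)] AB(3) rooted[OF AB(2)]])
    then show "condensation_weight G v e \<le> (case e of (A, B) \<Rightarrow> sum v (T A) + v (link A))"
      using gf.link_eq[OF AB(1)] by (simp add: e)
  qed
  also have "\<dots> = (\<Sum>A\<in>D. sum v (T A) + v (link A))"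
    by (rule gf.sum_over_D)
  finally have 1: "sum (condensation_weight G v) gf.quotient_rel \<le> \<dots>" .
  have "(\<Sum>A\<in>?P - D. min_tree_weight (with_proj G \<restriction> A) v) \<le> (\<Sum>A\<in>?P - D. ereal (sum v (T A)))"
    using T unfolding min_tree_weight_induced by (intro sum_mono INF_lower) blast
  then have 2: "(\<Sum>A\<in>?P - D. min_tree_weight (with_proj G \<restriction> A) v) \<le> ereal (\<Sum>A\<in>?P - D. sum v (T A))"
    by simp
  have "condensation_phi G v k n \<le> condensation_forest_weight G v (digr ?P gf.quotient_rel)"
    unfolding condensation_phi_eq by (rule INF_lower[OF mem])
  also have "\<dots> \<le> ereal (\<Sum>A\<in>D. sum v (T A) + v (link A)) + ereal (\<Sum>A\<in>?P - D. sum v (T A))"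
    unfolding condensation_forest_weight_digr[OF forest_relD(3)[OF forest]] gf.quotient_props(2)
    using 1 2 by (intro add_mono) simp_all
  also have "\<dots> = ereal (sum v R)"
    using gf.sum_glued[of v] gf.sum_trees_split[of "\<lambda>A. sum v (T A)"] by (simp add: \<open>gf.glued = R\<close> sum.distrib)
  also have "\<dots> = phi (with_proj G) v n"
    by (simp add: phi_min_rels[OF pair_wf_digraph_axioms R])
  finally show ?thesis .
qed

end

section \<open>The two claims for potential weights\<close>

context potential_digraph
begin

lemma min_forest_tree_on_elementary:
  assumes strict: "strictly_convex_at k" and ne: "min_rels V v k \<noteq> {}" and "n \<le> k"
    and F: "F \<in> min_forests V v n" and E: "E \<in> elementary_sets (aleph V v k)"
  shows "directed_tree (F \<restriction> E)"
proof -
  obtain R where R: "R \<in> min_rels V v n" "F = digr (pverts V) R"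
    using F unfolding min_forests_eq[OF pair_wf_digraph_axioms] by (rule imageE)
  obtain x where x: "x \<in> pverts V" "E = cohesion_class V v k x"
    using E unfolding elementary_sets_aleph[OF pair_fin_digraph_axioms] by blast
  have "F \<restriction> E = digr E (R \<inter> E \<times> E)"
    by (simp add: R(2) induce_digr)
  then show ?thesis
    using min_rel_tree_on_class[OF strict \<open>n \<le> k\<close> ne R(1) x(1)] by (simp add: directed_tree_digr x(2))
qed

lemma phi_eq_condensation_phi:
  assumes strict: "strictly_convex_at k" and ne: "min_rels V v k \<noteq> {}" and "n \<le> k"
  shows "phi V v n = condensation_phi V v k n"
proof (rule antisym)
  obtain R where R: "R \<in> min_rels V v k" using ne by blast
  show "phi V v n \<le> condensation_phi V v k n"
  proof (rule phi_le_condensation_phi)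
    fix A assume "A \<in> cohesion_class V v k ` pverts V"
    then obtain x where x: "x \<in> pverts V" "A = cohesion_class V v k x" by blast
    \<comment> \<open>A minimal forest of level \<open>k\<close>, not \<open>n\<close>, provides the
      trees: level \<open>n\<close> may be empty.\<close>
    have "R \<inter> A \<times> A \<in> spanning_rels (sub_digraph V A) 1"
      using min_rel_tree_on_class[OF strict order_refl ne R x(1)] min_relsD(3)[OF R]
      unfolding spanning_rels_sub_digraph x(2) by blast
    then show "spanning_rels (sub_digraph V A) 1 \<noteq> {}" by blast
  qed
  show "condensation_phi V v k n \<le> phi V v n"
  proof (cases "spanning_rels V n = {}")
    case True
    then show ?thesis by (simp add: phi_eq[OF pair_wf_digraph_axioms] top_ereal_def)
  next
    case False
    then obtain S where S: "S \<in> min_rels V v n"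
      using min_rels_nonempty[OF pair_finite_arcs] by blast
    show ?thesis
    proof (rule condensation_phi_le_phi[OF S])
      fix A assume "A \<in> cohesion_class V v k ` pverts V"
      then show "forest_rel A (S \<inter> A \<times> A) \<and> card (A - Domain (S \<inter> A \<times> A)) = 1"
        using min_rel_tree_on_class[OF strict \<open>n \<le> k\<close> ne S] by blast
    qed
  qed
qed

end

lemma potential_weightsE:
  assumes "potential_weights V v" "pair_digraph V" "r \<notin> pverts V"
  obtains w where "potential_digraph V v r w"
proof -
  interpret pair_digraph V by fact
  obtain Ed p where "\<forall>i j. {i, j} \<in> Ed \<longrightarrow> p i j = p j i"
    and "\<forall>i\<in>pverts V. \<forall>j\<in>pverts V. i \<noteq> j \<longrightarrow>
      ((i, j) \<in> parcs V \<longleftrightarrow> {i, j} \<in> Ed) \<and> ((i, j) \<in> parcs V \<longrightarrow> v (i, j) = p i j - p i i)"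
    using assms(1) unfolding potential_weights_def by (elim exE conjE that)
  then have sym: "\<And>i j. {i, j} \<in> Ed \<Longrightarrow> p i j = p j i"
    and Ed: "\<And>i j. i \<in> pverts V \<Longrightarrow> j \<in> pverts V \<Longrightarrow> i \<noteq> j \<Longrightarrow>
      ((i, j) \<in> parcs V \<longleftrightarrow> {i, j} \<in> Ed) \<and> ((i, j) \<in> parcs V \<longrightarrow> v (i, j) = p i j - p i i)"
    by blast+
  have arc: "{i, j} \<in> Ed" "v (i, j) = p i j - p i i" "i \<in> pverts V" "j \<in> pverts V" "i \<noteq> j"
    if "(i, j) \<in> parcs V" for i j
    using that Ed[of i j] wellformed'[OF that] pair_no_loops[OF that] by auto
  \<comment> \<open>Spokes carry \<open>p i i\<close>. On other edges \<open>SOME\<close> picks one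
    of the two orders of the ends, and symmetry of \<open>p\<close> on \<open>Ed\<close> makes the
    value independent of it.\<close>
  define w where "w e = (if r \<in> e then p (the_elem (e - {r})) (the_elem (e - {r}))
    else (SOME q. \<exists>i j. e = {i, j} \<and> q = p i j))" for e
  have wr: "w {r, i} = p i i" if "i \<in> pverts V" for i
  proof -
    have "{r, i} - {r} = {i}" using that assms(3) by auto
    then show ?thesis by (simp add: w_def)
  qed
  have wE: "w {i, j} = p i j" if "(i, j) \<in> parcs V" for i j
  proof -
    have "r \<notin> {i, j}" using arc(3,4)[OF that] assms(3) by auto
    moreover have "(SOME q. \<exists>a b. {i, j} = {a, b} \<and> q = p a b) = p i j"
    proof (rule some_equality)
      fix q assume "\<exists>a b. {i, j} = {a, b} \<and> q = p a b"
      then show "q = p i j" using sym[OF arc(1)[OF that]] by (auto simp: doubleton_eq_iff)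
    qed blast
    ultimately show ?thesis by (simp add: w_def)
  qed
  have "potential_digraph V v r w"
  proof
    fix i j assume ij: "(i, j) \<in> parcs V"
    show "(j, i) \<in> parcs V"
      using Ed[of j i] arc[OF ij] by (simp add: insert_commute)
    show "v (i, j) = w {i, j} - w {r, i}"
      using wE[OF ij] wr arc[OF ij] by simp
  qed (rule assms(3))
  then show thesis by (rule that)
qed

theorem theorem8:
  fixes V :: "nat pair_pre_digraph" and v :: "(nat \<times> nat) weight_fun" and N k :: nat
  assumes "pair_digraph V"
    and "pverts V = {1..N}"
    and "potential_weights V v"
    and "2 \<le> k" and "k \<le> N - 1"
    and "spanning_forests V k \<noteq> {}"
    and "phi V v (k - 1) - phi V v k > phi V v k - phi V v (k + 1)"
  shows "(\<forall>n\<le>k. \<forall>F\<in>min_forests V v n. \<forall>E\<in>elementary_sets (aleph V v k).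
            directed_tree (F \<restriction> E))
       \<and> (\<forall>n\<le>k. phi V v n = condensation_phi V v k n)"
proof -
  \<comment> \<open>The vertices are numbered from 1, so 0 is free for the extra vertex
    \<open>r\<close>.\<close>
  obtain w where "potential_digraph V v 0 w"
    using potential_weightsE[OF assms(3,1), of 0] assms(2) by auto
  then interpret potential_digraph V v 0 w .
  have "spanning_rels V k \<noteq> {}"
    using assms(6) unfolding spanning_forests_eq[OF pair_wf_digraph_axioms] by blast
  then have ne: "min_rels V v k \<noteq> {}"
    by (rule min_rels_nonempty[OF pair_finite_arcs])
  have "strictly_convex_at k"
    using strictly_convex_atI[OF _ ne assms(7)] assms(4) by simp
  with ne show ?thesis
    using min_forest_tree_on_elementary phi_eq_condensation_phi by blast
qed

end
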